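(* Let $(\mathcal{X}_1,\mathcal{X}_2,p(y_2|x_1)p(y_3|x_1,x_2,y_2),\mathcal{Y}_2,\mathcal{Y}_3)$ be a discrete memoryless noncausal relay channel with capacity $C_\infty$. Then \begin{align*} C_{\infty} \geq \max \min \{ &I(V,U;Y_3)+I(X_1;U,Y_3|V)-I(U;Y_2|V),\\ & I(V;Y_2)+I(X_1;U,Y_3|V),\\ & I(V;Y_2)+ I(X_1;U,Y_3|V)+I(U;Y_3|V)-I(U;Y_2|V)\}, \end{align*} where the maximum is over all pmfs $p(v,x_1)p(u|v,y_2)$ (with $V,U$ taking values in finite sets) and all functions $x_2(u,v,y_2)$, and the mutual informations are evaluated under the joint distribution $p(v,x_1)p(y_2|x_1)p(u|v,y_2)\mathbf{1}\{x_2=x_2(u,v,y_2)\}p(y_3|x_1,x_2,y_2)$.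
   Context: A discrete memoryless (DM) noncausal relay channel consists of finite alphabets $\mathcal{X}_1,\mathcal{X}_2,\mathcal{Y}_2,\mathcal{Y}_3$ and conditional pmfs $p(y_2|x_1)$ and $p(y_3|x_1,x_2,y_2)$; the sender inputs $X_1$, the relay observes $Y_2$ and inputs $X_2$, the receiver observes $Y_3$. It is memoryless: $p(y_{2i}|x_1^i,y_2^{i-1},m)=p(y_{2i}|x_{1i})$ and $p(y_{3i}|x_1^i,x_2^i,y_2^i,y_3^{i-1},m)=p(y_{3i}|x_{1i},x_{2i},y_{2i})$. A $(2^{nR},n)$ code consists of a message set $[1:2^{nR}]$, an encoder assigning a codeword $x_1^n(m)$ to each message $m$, a relay encoder assigning a symbol $x_{2i}(y_2^n)$ for each $i\in[1:n]$ as a function of the entire received sequence $y_2^n$ (noncausal, i.e., unlimited lookahead), and a decoder assigning an estimate $\hat m(y_3^n)$ or an error. The message $M$ is uniform over $[1:2^{nR}]$, the error probability is $P_e^{(n)}=\mathbb{P}\{\hat M\neq M\}$, a rate $R$ is achievable if there is a sequence of $(2^{nR},n)$ codes with $P_e^{(n)}\to 0$, and the capacity $C_\infty$ is the supremum of achievable rates. *)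

theory Defs
  imports "HOL-Probability.Probability"
begin

definition cmi :: "'a::finite pmf \<Rightarrow> ('a \<Rightarrow> 'b) \<Rightarrow> ('a \<Rightarrow> 'c) \<Rightarrow> ('a \<Rightarrow> 'd) \<Rightarrow> real" where
  "cmi J A B C =
    (let PABC = map_pmf (\<lambda>\<omega>. (A \<omega>, B \<omega>, C \<omega>)) J;
         PAC = map_pmf (\<lambda>\<omega>. (A \<omega>, C \<omega>)) J;
         PBC = map_pmf (\<lambda>\<omega>. (B \<omega>, C \<omega>)) J;
         PC = map_pmf C J
     in (\<Sum>(a, b, c) \<in> set_pmf PABC.
           pmf PABC (a, b, c) *
           log 2 (pmf PABC (a, b, c) * pmf PC c / (pmf PAC (a, c) * pmf PBC (b, c)))))"

definition mi :: "'a::finite pmf \<Rightarrow> ('a \<Rightarrow> 'b) \<Rightarrow> ('a \<Rightarrow> 'c) \<Rightarrow> real" where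
  "mi J A B = cmi J A B (\<lambda>_. ())"

text \<open>Channel: W2 x1 = p(y2|x1), W3 x1 x2 y2 = p(y3|x1,x2,y2).
  A (M, n) code: encoder enc m (a length-n list, for m in {1..M}),
  noncausal relay rel (maps the whole received y2^n to x2^n, so x_{2i} depends on all of y2^n),
  decoder dec (None = error declaration).
  Average error probability for a uniform message, using the memoryless law
  prod_i p(y2i|x1i) p(y3i|x1i,x2i,y2i).\<close>

definition nc_error_prob ::
  "('x1::finite \<Rightarrow> 'y2::finite pmf) \<Rightarrow> ('x1 \<Rightarrow> 'x2 \<Rightarrow> 'y2 \<Rightarrow> 'y3::finite pmf) \<Rightarrow> nat \<Rightarrow> nat
    \<Rightarrow> (nat \<Rightarrow> 'x1 list) \<Rightarrow> ('y2 list \<Rightarrow> 'x2 list) \<Rightarrow> ('y3 list \<Rightarrow> nat option) \<Rightarrow> real" where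
  "nc_error_prob W2 W3 n M enc rel dec =
     (1 / real M) * (\<Sum>m \<in> {1..M}. \<Sum>y2s \<in> {ys. length ys = n}. \<Sum>y3s \<in> {ys. length ys = n}.
        (\<Prod>i<n. pmf (W2 (enc m ! i)) (y2s ! i) *
                 pmf (W3 (enc m ! i) (rel y2s ! i) (y2s ! i)) (y3s ! i)) *
        (if dec y3s = Some m then 0 else 1))"

definition nc_valid_code :: "nat \<Rightarrow> nat \<Rightarrow> (nat \<Rightarrow> 'x1 list) \<Rightarrow> ('y2 list \<Rightarrow> 'x2 list) \<Rightarrow> bool" where
  "nc_valid_code n M enc rel \<longleftrightarrow>
     (\<forall>m \<in> {1..M}. length (enc m) = n) \<and> (\<forall>ys. length ys = n \<longrightarrow> length (rel ys) = n)"

definition num_msgs :: "nat \<Rightarrow> real \<Rightarrow> nat" where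
  "num_msgs n R = nat \<lceil>2 powr (real n * R)\<rceil>"

definition nc_achievable ::
  "('x1::finite \<Rightarrow> 'y2::finite pmf) \<Rightarrow> ('x1 \<Rightarrow> 'x2 \<Rightarrow> 'y2 \<Rightarrow> 'y3::finite pmf) \<Rightarrow> real \<Rightarrow> bool" where
  "nc_achievable W2 W3 R \<longleftrightarrow> 0 \<le> R \<and>
     (\<exists>(enc :: nat \<Rightarrow> nat \<Rightarrow> 'x1 list) (rel :: nat \<Rightarrow> 'y2 list \<Rightarrow> 'x2 list) (dec :: nat \<Rightarrow> 'y3 list \<Rightarrow> nat option).
        (\<forall>n. nc_valid_code n (num_msgs n R) (enc n) (rel n)) \<and>
        (\<lambda>n. nc_error_prob W2 W3 n (num_msgs n R) (enc n) (rel n) (dec n)) \<longlonglongrightarrow> 0)"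

definition nc_capacity ::
  "('x1::finite \<Rightarrow> 'y2::finite pmf) \<Rightarrow> ('x1 \<Rightarrow> 'x2 \<Rightarrow> 'y2 \<Rightarrow> 'y3::finite pmf) \<Rightarrow> ereal" where
  "nc_capacity W2 W3 = Sup (ereal ` {R. nc_achievable W2 W3 R})"

definition relay_joint ::
  "('v \<times> 'x1) pmf \<Rightarrow> ('x1 \<Rightarrow> 'y2 pmf) \<Rightarrow> ('v \<Rightarrow> 'y2 \<Rightarrow> 'u pmf) \<Rightarrow> ('u \<Rightarrow> 'v \<Rightarrow> 'y2 \<Rightarrow> 'x2)
    \<Rightarrow> ('x1 \<Rightarrow> 'x2 \<Rightarrow> 'y2 \<Rightarrow> 'y3 pmf) \<Rightarrow> ('v \<times> 'x1 \<times> 'y2 \<times> 'u \<times> 'x2 \<times> 'y3) pmf" where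
  "relay_joint pVX W2 pU x2f W3 =
     bind_pmf pVX (\<lambda>(v, x1). bind_pmf (W2 x1) (\<lambda>y2. bind_pmf (pU v y2) (\<lambda>u.
       map_pmf (\<lambda>y3. (v, x1, y2, u, x2f u v y2, y3)) (W3 x1 (x2f u v y2) y2))))"

end

theory Submission
  imports Defs
begin

text \<open>
  The proof is a one-shot random coding argument with stochastic likelihood coders, so no
  Markov lemma is needed. The codebook consists of clouds: a centre v, satellites
  x_j drawn from p(x|v) carrying the rest of the message, and satellites u_l drawn from p(u|v).
  Seeing y2, the relay draws a cloud with probability proportional to p(y2|v)/p(y2), and inside that
  cloud an index l with probability proportional to p(u_l|v,y2)/p(u_l|v). Seeing y3, the receiver
  draws a message with probability proportional to the sum over l of
  p(v,u_l,x_j,y3)/(p(v) p(u_l|v) p(x_j|v) p(y3)). For a fixed message and index, the weight of the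
  selected u turns the codebook law into exactly the target joint law, while all other codewords stay
  independent. The success probability becomes the expectation of 1/(a b c), where a, b, c are the
  normalising sums divided by their leading terms, and 1/(a b c) \<ge> 4 - a - b - c is linear in the
  independent codewords. What remains are the five error exponents of the theorem, evaluated with
  information densities; a Chernoff bound shows that these concentrate. Fixing the codebook and
  replacing the random choices by maximisers gives a deterministic code.
\<close>

section \<open>Finite expectations and information densities\<close>

text \<open>Since the relay sees the whole \<open>y2\<close> block before acting, a single block
  suffices: inside the cloud it recognises, it describes \<open>y2\<close> by a satellite
  \<open>u\<close>. With rates R1 (clouds), R2 (satellites \<open>x\<close>) and RL (satellites
  \<open>u\<close>), the five exponents demand R1 < I(V;Y2), RL > I(U;Y2|V), R2 < I(X1;U,Y3|V), R2 +
  RL < I(X1;U,Y3|V) + I(U;Y3|V) and R1 + R2 + RL < I(V,U;Y3) + I(X1;U,Y3|V). Eliminating R1, R2 and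
  RL leaves the three terms of the minimum. The obstacle is that the selected index depends on
  \<open>y2\<close> and on all codewords, so that conditioning on it would destroy the independence
  of the codebook. Here the selection enters only as an explicit weight, whose numerator involves
  the true codewords and whose denominator is a sum over all of them. U stands beside Y3 in
  I(X1;U,Y3|V) because \<open>x\<close> and \<open>u\<close> are drawn independently given
  \<open>v\<close>, whereas the selected \<open>u\<close> is correlated with the true
  \<open>x\<close> through \<open>y2\<close>: a wrong \<open>x\<close> fails to match
  \<open>u\<close> as well as \<open>y3\<close>.\<close>

abbreviation expect :: "'a pmf \<Rightarrow> ('a \<Rightarrow> real) \<Rightarrow> real" where
  "expect \<equiv> measure_pmf.expectation"

lemma expect_mono:
  assumes "finite (set_pmf p)" "\<And>x. x \<in> set_pmf p \<Longrightarrow> f x \<le> g x"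
  shows "expect p f \<le> expect p g"
  using assms by (intro integral_mono_AE integrable_measure_pmf_finite AE_pmfI) auto

lemma expect_cong:
  assumes "\<And>x. x \<in> set_pmf p \<Longrightarrow> f x = g x"
  shows "expect p f = expect p g"
  using assms by (intro integral_cong_AE AE_pmfI) auto

lemma expect_nonneg:
  assumes "\<And>x. x \<in> set_pmf p \<Longrightarrow> 0 \<le> f x"
  shows "0 \<le> expect p f"
  using assms by (intro integral_nonneg_AE AE_pmfI)

lemma expect_add:
  assumes "finite (set_pmf p)"
  shows "expect p (\<lambda>x. f x + g x) = expect p f + expect p g"
  using assms by (intro Bochner_Integration.integral_add integrable_measure_pmf_finite)

lemma expect_diff:
  assumes "finite (set_pmf p)"
  shows "expect p (\<lambda>x. f x - g x) = expect p f - expect p g"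
  using assms by (intro Bochner_Integration.integral_diff integrable_measure_pmf_finite)

lemma expect_sum:
  assumes "finite (set_pmf p)"
  shows "expect p (\<lambda>x. \<Sum>k\<in>K. f k x) = (\<Sum>k\<in>K. expect p (f k))"
  using assms by (intro Bochner_Integration.integral_sum integrable_measure_pmf_finite)

lemma expect_bind:
  assumes "finite (set_pmf p)" "\<And>x. x \<in> set_pmf p \<Longrightarrow> finite (set_pmf (f x))"
  shows "expect (bind_pmf p f) h = expect p (\<lambda>x. expect (f x) h)"
  using assms
  by (subst pmf_expectation_bind[of "set_pmf p"]) (auto simp: integral_measure_pmf[of "set_pmf p"])

lemma ex_ge_expect:
  assumes "finite (set_pmf p)"
  shows "\<exists>x\<in>set_pmf p. expect p f \<le> f x"
proof (rule ccontr)
  define m where "m = Max (f ` set_pmf p)"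
  have "m \<in> f ` set_pmf p"
    unfolding m_def using assms by (intro Max_in) (auto simp: set_pmf_not_empty)
  then obtain x where x: "x \<in> set_pmf p" "m = f x" by auto
  assume "\<not> ?thesis"
  hence "f x < expect p f" using x by force
  moreover have "expect p f \<le> expect p (\<lambda>_. m)"
    using assms by (intro expect_mono) (auto simp: m_def)
  ultimately show False using x by simp
qed

lemma finite_set_Pi_pmf:
  assumes "finite A" "\<And>x. x \<in> A \<Longrightarrow> finite (set_pmf (p x))"
  shows "finite (set_pmf (Pi_pmf A d p))"
  using assms by (subst set_Pi_pmf) auto

text \<open>Independence of the codewords is only ever used in this form.\<close>

lemma Pi_pmf_resample:
  assumes "finite A" "k \<in> A"
  shows "bind_pmf (Pi_pmf A d p) (\<lambda>f. map_pmf (\<lambda>y. f(k := y)) (p k)) = Pi_pmf A d p"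
proof -
  define A' where "A' = A - {k}"
  have A: "A = insert k A'" "finite A'" "k \<notin> A'" using assms by (auto simp: A'_def)
  show ?thesis unfolding A(1)
    by (subst (1 2) Pi_pmf_insert'[OF A(2,3)])
       (simp add: bind_assoc_pmf bind_return_pmf map_pmf_def
         bind_commute_pmf[of "p k" "Pi_pmf A' d p"])
qed

lemma expect_Pi_resample:
  assumes "finite A" "k \<in> A" "\<And>x. x \<in> A \<Longrightarrow> finite (set_pmf (p x))"
  shows "expect (Pi_pmf A d p) F = expect (Pi_pmf A d p) (\<lambda>f. expect (p k) (\<lambda>y. F (f(k := y))))"
proof -
  have "expect (Pi_pmf A d p) F
      = expect (bind_pmf (Pi_pmf A d p) (\<lambda>f. map_pmf (\<lambda>y. f(k := y)) (p k))) F"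
    using assms by (simp only: Pi_pmf_resample)
  also have "\<dots> = expect (Pi_pmf A d p) (\<lambda>f. expect (p k) (\<lambda>y. F (f(k := y))))"
    using assms by (subst expect_bind) (auto intro: finite_set_Pi_pmf)
  finally show ?thesis .
qed

lemma expect_Pi_component:
  assumes "finite A" "k \<in> A"
  shows "expect (Pi_pmf A d p) (\<lambda>f. h (f k)) = expect (p k) h"
proof -
  have "expect (p k) h = expect (map_pmf (\<lambda>f. f k) (Pi_pmf A d p)) h"
    using assms by (simp add: Pi_pmf_component)
  thus ?thesis by simp
qed

section \<open>Linearisation and derandomisation inequalities\<close>

text \<open>The right side is \<open>exp (- ln a - ln b - ln c)\<close>; bounding \<open>exp\<close>
  and each \<open>ln\<close> by its tangent gives the left side. Equality holds at a = b = c = 1,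
  near which the normalised loads lie on average, so little is lost, and three dependent reciprocals
  become sums that can be averaged separately.\<close>

lemma inverse_mult3_ge:
  fixes a b c :: real
  assumes "0 < a" "0 < b" "0 < c"
  shows "4 - a - b - c \<le> 1 / (a * b * c)"
proof -
  have "4 - a - b - c \<le> 1 + (- ln a - ln b - ln c)"
    using ln_le_minus_one[of a] ln_le_minus_one[of b] ln_le_minus_one[of c] assms by simp
  also have "\<dots> \<le> exp (- ln a - ln b - ln c)" by (rule exp_ge_add_one_self)
  also have "\<dots> = 1 / (a * b * c)" using assms by (simp add: exp_diff exp_minus exp_add field_simps)
  finally show ?thesis .
qed

text \<open>This turns a stochastic choice into its best outcome. The weights may sum to less than
  one, so nonnegativity of \<open>F\<close> is what keeps the maximum above the weighted
  sum.\<close>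

lemma ex_ge_weighted_sum:
  fixes K F :: "'a \<Rightarrow> real"
  assumes "finite I" "I \<noteq> {}" "\<And>k. k \<in> I \<Longrightarrow> 0 \<le> K k" "sum K I \<le> 1"
    "\<And>k. k \<in> I \<Longrightarrow> 0 \<le> F k"
  shows "\<exists>k\<in>I. (\<Sum>k\<in>I. K k * F k) \<le> F k"
proof -
  have "Max (F ` I) \<in> F ` I" using assms by (intro Max_in) auto
  then obtain k where k: "k \<in> I" "Max (F ` I) = F k" by auto
  have "(\<Sum>k\<in>I. K k * F k) \<le> (\<Sum>k'\<in>I. K k' * F k)"
    using assms k(2)[symmetric] by (intro sum_mono mult_left_mono) auto
  also have "\<dots> \<le> F k"
    using assms k(1) mult_right_mono[of "sum K I" 1 "F k"] by (simp add: sum_distrib_right)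
  finally show ?thesis using k by blast
qed

lemma sum_divide_sum_le_1:
  fixes f :: "'a \<Rightarrow> real"
  shows "(\<Sum>x\<in>A. f x / sum f A) \<le> 1"
  by (cases "sum f A = 0") (simp_all flip: sum_divide_distrib)

lemma sum_swap3:
  "(\<Sum>x\<in>A. \<Sum>y\<in>B. \<Sum>z\<in>C. f x y z) = (\<Sum>z\<in>C. \<Sum>x\<in>A. \<Sum>y\<in>B. f x y z)"
proof -
  have "(\<Sum>x\<in>A. \<Sum>y\<in>B. \<Sum>z\<in>C. f x y z) = (\<Sum>x\<in>A. \<Sum>z\<in>C. \<Sum>y\<in>B. f x y z)"
    by (intro sum.cong refl sum.swap)
  also have "\<dots> = (\<Sum>z\<in>C. \<Sum>x\<in>A. \<Sum>y\<in>B. f x y z)" by (rule sum.swap)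
  finally show ?thesis .
qed

lemma expect_UNIV: "expect (p :: 'a :: finite pmf) f = (\<Sum>x\<in>UNIV. pmf p x * f x)"
  by (simp add: integral_measure_pmf[of UNIV])

lemma expect_single: "expect p (\<lambda>x. if x = a then c else 0) = pmf p a * c"
  by (subst integral_measure_pmf[of "{a}"]) (auto split: if_splits)

lemma prob_eq_expect: "measure_pmf.prob p {x. Q x} = expect p (\<lambda>x. if Q x then 1 else 0)"
proof -
  have "(\<lambda>x. if Q x then 1 else 0 :: real) = indicator {x. Q x}" by (auto simp: fun_eq_iff)
  thus ?thesis by simp
qed

lemma sum_prob_conj_le:
  assumes "finite S"
  shows "(\<Sum>a\<in>S. measure_pmf.prob p {x. A x = a \<and> Q x}) \<le> measure_pmf.prob p {x. Q x}"
proof -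
  have "(\<Sum>a\<in>S. measure_pmf.prob p {x. A x = a \<and> Q x}) = measure_pmf.prob p (\<Union>a\<in>S. {x. A x = a \<and> Q x})"
    using assms by (subst measure_pmf.finite_measure_finite_Union) (auto simp: disjoint_family_on_def)
  also have "\<dots> \<le> measure_pmf.prob p {x. Q x}"
    by (intro measure_pmf.finite_measure_mono) auto
  finally show ?thesis .
qed

lemma prob_pos:
  assumes "x \<in> set_pmf p" "Q x"
  shows "0 < measure_pmf.prob p {x. Q x}"
  using assms by (auto simp: measure_pmf_posI)

text \<open>The theorem is given a joint pmf of (v, x), whereas the codebook draws \<open>v\<close>
  and then \<open>x\<close> given \<open>v\<close>. The kernel is a conditional pmf; outside the
  support of \<open>v\<close> its value is arbitrary, which is harmless because
  \<open>bind_pmf\<close> reads it only on the support.\<close>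

lemma pmf_disintegrate:
  obtains k where "p = bind_pmf (map_pmf fst p) (\<lambda>v. map_pmf (Pair v) (k v))"
proof -
  define k where "k v = map_pmf snd (cond_pmf p {z. v = fst z})" for v
  have "bind_pmf (map_pmf fst p) (\<lambda>v. map_pmf (Pair v) (k v))
      = bind_pmf (map_pmf fst p) (\<lambda>v. cond_pmf p {z. v = fst z})"
  proof (rule bind_pmf_cong[OF refl])
    fix v assume "v \<in> set_pmf (map_pmf fst p)"
    hence ne: "set_pmf p \<inter> {z. v = fst z} \<noteq> {}" by auto
    have "map_pmf (Pair v) (k v) = map_pmf (\<lambda>z. z) (cond_pmf p {z. v = fst z})"
      unfolding k_def map_pmf_comp by (intro map_pmf_cong refl) (auto simp: set_cond_pmf[OF ne])
    thus "map_pmf (Pair v) (k v) = cond_pmf p {z. v = fst z}" by simp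
  qed
  also have "\<dots> = p"
    by (rule bind_cond_pmf_cancel)
       (auto simp: vimage_def eq_commute intro!: arg_cong[of _ _ "measure_pmf.prob p"])
  finally show ?thesis using that by metis
qed

section \<open>Information densities and exponential tails\<close>

text \<open>Pulling the sum over values back to \<open>J\<close> exposes the integrand as an
  information density, the random variable whose sum over a block the Chernoff bound
  controls.\<close>

lemma cmi_eq_expect:
  fixes J :: "'a::finite pmf"
  shows "cmi J A B C = expect J (\<lambda>\<omega>. log 2
    (measure_pmf.prob J {\<omega>'. A \<omega>' = A \<omega> \<and> B \<omega>' = B \<omega> \<and> C \<omega>' = C \<omega>} * measure_pmf.prob J {\<omega>'. C \<omega>' = C \<omega>}
     / (measure_pmf.prob J {\<omega>'. A \<omega>' = A \<omega> \<and> C \<omega>' = C \<omega>} * measure_pmf.prob J {\<omega>'. B \<omega>' = B \<omega> \<and> C \<omega>' = C \<omega>})))"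
proof -
  let ?P = "map_pmf (\<lambda>\<omega>. (A \<omega>, B \<omega>, C \<omega>)) J"
  define f where "f = (\<lambda>(a, b, c). log 2 (pmf ?P (a, b, c) * pmf (map_pmf C J) c /
      (pmf (map_pmf (\<lambda>\<omega>. (A \<omega>, C \<omega>)) J) (a, c) * pmf (map_pmf (\<lambda>\<omega>. (B \<omega>, C \<omega>)) J) (b, c))))"
  have "cmi J A B C = (\<Sum>z\<in>set_pmf ?P. pmf ?P z * f z)"
    unfolding cmi_def Let_def f_def by (intro sum.cong refl) auto
  also have "\<dots> = expect ?P f"
    by (subst integral_measure_pmf[of "set_pmf ?P"]) auto
  also have "\<dots> = expect J (\<lambda>\<omega>. f (A \<omega>, B \<omega>, C \<omega>))" by simp
  finally show ?thesis by (simp add: f_def pmf_map vimage_def)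
qed

lemma mi_eq_expect:
  fixes J :: "'a::finite pmf"
  shows "mi J A B = expect J (\<lambda>\<omega>. log 2
    (measure_pmf.prob J {\<omega>'. A \<omega>' = A \<omega> \<and> B \<omega>' = B \<omega>}
     / (measure_pmf.prob J {\<omega>'. A \<omega>' = A \<omega>} * measure_pmf.prob J {\<omega>'. B \<omega>' = B \<omega>})))"
  unfolding mi_def cmi_eq_expect by simp

text \<open>As a function of s, the expectation is one at s = 0 and has derivative t - E f < 0
  there, so it drops below one for small positive s. Its n-th power will bound the lower tail of a
  sum over n letters.\<close>

lemma chernoff_base:
  assumes fin: "finite (set_pmf p)" and t: "t < expect p f"
  shows "\<exists>s>0. expect p (\<lambda>x. exp (- s * (f x - t))) < 1"
proof -
  define g where "g s = (\<Sum>x\<in>set_pmf p. pmf p x * exp (- s * (f x - t)))" for s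
  have g: "expect p (\<lambda>x. exp (- s * (f x - t))) = g s" for s
    unfolding g_def using fin by (subst integral_measure_pmf[of "set_pmf p"]) auto
  have "(g has_real_derivative (\<Sum>x\<in>set_pmf p. pmf p x * (- (f x - t)))) (at 0)"
    unfolding g_def by (auto intro!: derivative_eq_intros sum.cong)
  moreover have "(\<Sum>x\<in>set_pmf p. pmf p x * (- (f x - t))) = - (expect p f - t)"
    using fin by (simp add: integral_measure_pmf[of "set_pmf p"] algebra_simps sum_subtractf
        sum_distrib_left[symmetric] sum_pmf_eq_1)
  ultimately obtain d where d: "0 < d" "\<forall>h>0. h < d \<longrightarrow> g (0 + h) < g 0"
    using DERIV_neg_dec_right[of g "- (expect p f - t)" 0] t by auto
  have "g 0 = 1" unfolding g[symmetric] by simp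
  with d show ?thesis unfolding g by (intro exI[of _ "d / 2"]) auto
qed

lemma sum_prod_lists:
  fixes f :: "nat \<Rightarrow> 'a::finite \<Rightarrow> 'b::comm_semiring_1"
  shows "(\<Sum>ys\<in>{ys. length ys = n}. \<Prod>i<n. f i (ys ! i)) = (\<Prod>i<n. \<Sum>y\<in>UNIV. f i y)"
proof (induction n arbitrary: f)
  case (Suc n)
  have eq: "{ys :: 'a list. length ys = Suc n} = (\<lambda>(y, ys). y # ys) ` (UNIV \<times> {ys. length ys = n})"
    by (auto simp: length_Suc_conv image_iff)
  have "(\<Sum>ys\<in>{ys. length ys = Suc n}. \<Prod>i<Suc n. f i (ys ! i))
      = (\<Sum>(y, ys)\<in>UNIV \<times> {ys. length ys = n}. f 0 y * (\<Prod>i<n. f (Suc i) (ys ! i)))"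
    unfolding eq by (subst sum.reindex)
      (auto simp: inj_on_def case_prod_unfold prod.lessThan_Suc_shift simp del: prod.lessThan_Suc)
  also have "\<dots> = (\<Sum>y\<in>UNIV. f 0 y) * (\<Sum>ys\<in>{ys. length ys = n}. \<Prod>i<n. f (Suc i) (ys ! i))"
    by (simp add: sum_product sum.cartesian_product)
  also have "\<dots> = (\<Prod>i<Suc n. \<Sum>y\<in>UNIV. f i y)"
    by (simp add: Suc.IH[of "\<lambda>i. f (Suc i)"] prod.lessThan_Suc_shift del: prod.lessThan_Suc)
  finally show ?case .
qed simp

text \<open>The random coding argument bounds success from below, hence this form. The total mass is
  one although every relay input may depend on all of \<open>y2s\<close>: with \<open>y2s\<close>
  held fixed, the inner sum over \<open>y3s\<close> factorises, and what remains is a plain product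
  in \<open>y2s\<close>.\<close>

lemma nc_error_prob_eq:
  assumes M: "1 \<le> M"
  shows "nc_error_prob W2 W3 n M enc rel dec = 1 - (1 / real M) *
    (\<Sum>m\<in>{1..M}. \<Sum>y2s\<in>{ys. length ys = n}. \<Sum>y3s\<in>{ys. length ys = n}.
      (\<Prod>i<n. pmf (W2 (enc m ! i)) (y2s ! i) * pmf (W3 (enc m ! i) (rel y2s ! i) (y2s ! i)) (y3s ! i)) *
      (if dec y3s = Some m then 1 else 0))"
proof -
  define p where "p m y2s y3s = (\<Prod>i<n. pmf (W2 (enc m ! i)) (y2s ! i) *
      pmf (W3 (enc m ! i) (rel y2s ! i) (y2s ! i)) (y3s ! i))" for m y2s y3s
  have total: "(\<Sum>y2s\<in>{ys. length ys = n}. \<Sum>y3s\<in>{ys. length ys = n}. p m y2s y3s) = 1" for m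
  proof -
    have "(\<Sum>y2s\<in>{ys. length ys = n}. \<Sum>y3s\<in>{ys. length ys = n}. p m y2s y3s)
        = (\<Sum>y2s\<in>{ys. length ys = n}. \<Prod>i<n. pmf (W2 (enc m ! i)) (y2s ! i))"
      unfolding p_def by (subst sum_prod_lists) (simp add: sum_pmf_eq_1 flip: sum_distrib_left)
    also have "\<dots> = 1"
      by (subst sum_prod_lists[where f = "\<lambda>i y. pmf (W2 (enc m ! i)) y"]) (simp add: sum_pmf_eq_1)
    finally show ?thesis .
  qed
  have "nc_error_prob W2 W3 n M enc rel dec = (1 / real M) *
    (\<Sum>m\<in>{1..M}. \<Sum>y2s\<in>{ys. length ys = n}. \<Sum>y3s\<in>{ys. length ys = n}.
      p m y2s y3s - p m y2s y3s * (if dec y3s = Some m then 1 else 0))"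
    unfolding nc_error_prob_def p_def
    by (intro arg_cong[of _ _ "\<lambda>x. (1 / real M) * x"] sum.cong refl) auto
  also have "\<dots> = (1 / real M) * (real M -
    (\<Sum>m\<in>{1..M}. \<Sum>y2s\<in>{ys. length ys = n}. \<Sum>y3s\<in>{ys. length ys = n}.
      p m y2s y3s * (if dec y3s = Some m then 1 else 0)))"
    by (simp only: sum_subtractf total) simp
  also have "\<dots> = 1 - (1 / real M) *
    (\<Sum>m\<in>{1..M}. \<Sum>y2s\<in>{ys. length ys = n}. \<Sum>y3s\<in>{ys. length ys = n}.
      p m y2s y3s * (if dec y3s = Some m then 1 else 0))"
    using M by (simp add: right_diff_distrib)
  finally show ?thesis unfolding p_def .
qed

lemma expect_prod_Pi:
  fixes f :: "'i \<Rightarrow> 'a::finite \<Rightarrow> real"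
  assumes "finite A" "\<And>i y. 0 \<le> f i y"
  shows "expect (Pi_pmf A d p) (\<lambda>y. \<Prod>i\<in>A. f i (y i)) = (\<Prod>i\<in>A. expect (p i) (f i))"
  using assms by (intro expectation_prod_Pi_pmf integrable_measure_pmf_finite) auto

section \<open>Message counts and rate splitting\<close>

lemma powr_le_prod:
  fixes \<beta> :: "nat \<Rightarrow> real"
  assumes "\<And>i. i < n \<Longrightarrow> 0 < \<beta> i" "x < (\<Sum>i<n. log 2 (\<beta> i))"
  shows "2 powr x \<le> (\<Prod>i<n. \<beta> i)"
proof -
  have "2 powr x \<le> 2 powr (\<Sum>i<n. log 2 (\<beta> i))" using assms by simp
  also have "\<dots> = (\<Prod>i<n. \<beta> i)" using assms(1) by (simp add: powr_sum)
  finally show ?thesis .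
qed

text \<open>A single message is guessed without looking at the output. This settles the theorem when
  its lower bound is not positive.\<close>

lemma nc_achievable_0: "nc_achievable W2 W3 0"
  unfolding nc_achievable_def
proof (intro conjI exI allI)
  show "nc_valid_code n (num_msgs n 0) (\<lambda>_. replicate n undefined) (\<lambda>_. replicate n undefined)" for n
    by (simp add: nc_valid_code_def)
  show "(\<lambda>n. nc_error_prob W2 W3 n (num_msgs n 0) (\<lambda>_. replicate n undefined) (\<lambda>_. replicate n undefined)
      (\<lambda>_. Some 1)) \<longlonglongrightarrow> 0"
    by (simp add: nc_error_prob_def num_msgs_def)
qed simp

text \<open>The second bound counts the competitors of a message and loses nothing to rounding. The
  third loses a factor 2, one source of the constant 4 in \<open>achievable\<close>. Rate 0 gives
  one message, hence no competitors at all.\<close>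

lemma num_msgs_bounds:
  shows "2 powr (real n * R) \<le> real (num_msgs n R)"
    and "real (num_msgs n R - 1) \<le> 2 powr (real n * R)"
    and "0 \<le> R \<Longrightarrow> real (num_msgs n R) \<le> 2 * 2 powr (real n * R)"
    and "1 \<le> num_msgs n R" and "num_msgs n 0 = 1"
proof -
  define x where "x = 2 powr (real n * R)"
  have x: "0 < x" by (simp add: x_def)
  hence c: "1 \<le> \<lceil>x\<rceil>" by linarith
  have N: "num_msgs n R = nat \<lceil>x\<rceil>" by (simp add: num_msgs_def x_def)
  have rN: "real (num_msgs n R) = of_int \<lceil>x\<rceil>" unfolding N using c by simp
  show one: "1 \<le> num_msgs n R" unfolding N using c by linarith
  show "2 powr (real n * R) \<le> real (num_msgs n R)" unfolding rN x_def[symmetric] by (rule le_of_int_ceiling)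
  have up: "real (num_msgs n R) \<le> x + 1" unfolding rN by linarith
  thus "real (num_msgs n R - 1) \<le> 2 powr (real n * R)"
    using one by (simp add: of_nat_diff x_def)
  show "real (num_msgs n R) \<le> 2 * 2 powr (real n * R)" if "0 \<le> R"
  proof -
    have "1 \<le> x" unfolding x_def using that by (simp add: ge_one_powr_ge_zero)
    thus ?thesis using up by (simp add: x_def)
  qed
  show "num_msgs n 0 = 1" by (simp add: num_msgs_def)
qed

lemma num_msgs_add_le: "num_msgs n (R1 + R2) \<le> num_msgs n R1 * num_msgs n R2"
proof -
  have "2 powr (real n * (R1 + R2)) = 2 powr (real n * R1) * 2 powr (real n * R2)"
    by (simp add: distrib_left powr_add)
  also have "\<dots> \<le> real (num_msgs n R1) * real (num_msgs n R2)"
    by (intro mult_mono num_msgs_bounds(1)) auto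
  finally have "2 powr (real n * (R1 + R2)) \<le> of_int (int (num_msgs n R1 * num_msgs n R2))" by simp
  hence "\<lceil>2 powr (real n * (R1 + R2))\<rceil> \<le> int (num_msgs n R1 * num_msgs n R2)"
    by (rule ceiling_le)
  thus ?thesis by (simp add: num_msgs_def[of n "R1 + R2"] nat_le_iff)
qed

text \<open>
  A component rate 0 means a single message, for which the corresponding error events are void; hence
  the case distinctions, which also cover bounds that are negative.
\<close>

lemma rate_split:
  fixes R IV A AD I5 K :: real
  assumes "0 \<le> R" "R < I5 - K" "R < IV + A" "R < IV + AD - K"
  obtains \<delta> R1 R2 where "0 < \<delta>" "0 \<le> R1" "0 \<le> R2" "R1 + R2 = R" "R1 = 0 \<or> R1 \<le> IV - 2 * \<delta>"
    "R2 = 0 \<or> R2 \<le> A - 2 * \<delta> \<and> R2 + K + 2 * \<delta> \<le> AD - 2 * \<delta>" "R + K + 2 * \<delta> \<le> I5 - 2 * \<delta>"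
proof -
  \<comment> \<open>Six in place of ten would do: four multiples of \<delta> are spent explicitly in
    the conclusions, and two more arise when R1 stays 2 * \<delta> below IV.\<close>
  define \<delta> where "\<delta> = min (I5 - K - R) (min (IV + A - R) (IV + AD - K - R)) / 10"
  have \<delta>: "0 < \<delta>" "10 * \<delta> \<le> I5 - K - R" "10 * \<delta> \<le> IV + A - R" "10 * \<delta> \<le> IV + AD - K - R"
    using assms unfolding \<delta>_def by auto
  show ?thesis
  proof (cases "R \<le> IV - 2 * \<delta>")
    case True
    show ?thesis by (rule that[of \<delta> R 0]) (use assms \<delta> True in auto)
  next
    case False
    \<comment> \<open>The clouds carry as much rate as the relay can decode and the satellites take
      the rest; truncation at 0 keeps R1 a rate if IV - 2 * \<delta> is negative.\<close>
    show ?thesis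
      by (rule that[of \<delta> "max 0 (IV - 2 * \<delta>)" "R - max 0 (IV - 2 * \<delta>)"])
         (use assms \<delta> False in \<open>auto simp: max_def\<close>)
  qed
qed

section \<open>One-shot superposition coding\<close>

text \<open>Letters are arbitrary here and will be whole blocks later. Those are functions on
  \<open>nat\<close>, an infinite type in general, so finiteness is required of the supports
  only.\<close>

locale superposition_coding =
  fixes pV :: "'v pmf" and pX :: "'v \<Rightarrow> 'x pmf" and pU :: "'v \<Rightarrow> 'u pmf"
    and M1 M2 L :: nat
  assumes finite_pV: "finite (set_pmf pV)"
    and finite_pX: "\<And>v. finite (set_pmf (pX v))"
    and finite_pU: "\<And>v. finite (set_pmf (pU v))"
begin

text \<open>Given the centre, the two families of satellites are independent, because the encoder
  cannot foresee which \<open>u\<close> the relay will select. Dependence between the true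
  \<open>x\<close> and the selected \<open>u\<close> enters only through the relay's
  weights.\<close>

definition cloud :: "('v \<times> (nat \<Rightarrow> 'x) \<times> (nat \<Rightarrow> 'u)) pmf" where
  "cloud = bind_pmf pV (\<lambda>v. bind_pmf (Pi_pmf {..<M2} undefined (\<lambda>_. pX v))
     (\<lambda>xs. map_pmf (\<lambda>us. (v, xs, us)) (Pi_pmf {..<L} undefined (\<lambda>_. pU v))))"

definition codebook :: "(nat \<Rightarrow> 'v \<times> (nat \<Rightarrow> 'x) \<times> (nat \<Rightarrow> 'u)) pmf" where
  "codebook = Pi_pmf {..<M1} undefined (\<lambda>_. cloud)"

lemmas finite_PiX = finite_set_Pi_pmf[OF finite_lessThan finite_pX]
lemmas finite_PiU = finite_set_Pi_pmf[OF finite_lessThan finite_pU]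

lemma finite_cloud: "finite (set_pmf cloud)"
  unfolding cloud_def set_bind_pmf set_map_pmf
  by (intro finite_UN_I finite_imageI finite_pV finite_PiX finite_PiU)

lemma finite_codebook: "finite (set_pmf codebook)"
  unfolding codebook_def by (intro finite_set_Pi_pmf finite_cloud finite_lessThan)

lemma expect_cloud:
  "expect cloud F = expect pV (\<lambda>v. expect (Pi_pmf {..<M2} undefined (\<lambda>_. pX v))
     (\<lambda>xs. expect (Pi_pmf {..<L} undefined (\<lambda>_. pU v)) (\<lambda>us. F (v, xs, us))))"
  unfolding cloud_def
  by (subst expect_bind) (auto simp: expect_bind finite_pV finite_PiX finite_PiU)

section \<open>Redrawing one codeword\<close>

text \<open>If index j occurs in only one factor of the integrand, redrawing it last replaces that
  factor by its conditional mean given the rest of the cloud.\<close>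

lemma cloud_resample_x:
  assumes "j < M2"
  shows "expect cloud F = expect cloud (\<lambda>(v, xs, us). expect (pX v) (\<lambda>x. F (v, xs(j := x), us)))"
proof -
  have "expect (Pi_pmf {..<L} undefined (\<lambda>_. pU v)) (\<lambda>us. expect (pX v) (\<lambda>x. F (v, xs(j := x), us)))
     = expect (pX v) (\<lambda>x. expect (Pi_pmf {..<L} undefined (\<lambda>_. pU v)) (\<lambda>us. F (v, xs(j := x), us)))" for v xs
    by (simp add: integral_measure_pmf[OF finite_pX[of v]] integral_measure_pmf[OF finite_PiU]
        sum_distrib_left mult.left_commute)
       (rule sum.swap)
  moreover have "expect (Pi_pmf {..<M2} undefined (\<lambda>_. pX v)) f
      = expect (Pi_pmf {..<M2} undefined (\<lambda>_. pX v)) (\<lambda>xs. expect (pX v) (\<lambda>x. f (xs(j := x))))" for v f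
    using assms by (intro expect_Pi_resample finite_pX) auto
  from this[of _ "\<lambda>xs. expect (Pi_pmf {..<L} undefined (\<lambda>_. pU _)) (\<lambda>us. F (_, xs, us))"]
  have "expect (Pi_pmf {..<M2} undefined (\<lambda>_. pX v))
       (\<lambda>xs. expect (Pi_pmf {..<L} undefined (\<lambda>_. pU v)) (\<lambda>us. F (v, xs, us)))
    = expect (Pi_pmf {..<M2} undefined (\<lambda>_. pX v)) (\<lambda>xs. expect (pX v)
       (\<lambda>x. expect (Pi_pmf {..<L} undefined (\<lambda>_. pU v)) (\<lambda>us. F (v, xs(j := x), us))))" for v
    by this
  ultimately show ?thesis
    unfolding expect_cloud by simp
qed

lemma cloud_resample_u:
  assumes "l < L"
  shows "expect cloud F = expect cloud (\<lambda>(v, xs, us). expect (pU v) (\<lambda>u. F (v, xs, us(l := u))))"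
proof -
  have "expect (Pi_pmf {..<L} undefined (\<lambda>_. pU v)) f
      = expect (Pi_pmf {..<L} undefined (\<lambda>_. pU v)) (\<lambda>us. expect (pU v) (\<lambda>u. f (us(l := u))))" for v f
    using assms by (intro expect_Pi_resample finite_pU) auto
  from this[of _ "\<lambda>us. F (_, _, us)"] show ?thesis
    unfolding expect_cloud by simp
qed

lemma expect_cloud_marginal:
  assumes "j < M2" "l < L"
  shows "expect cloud (\<lambda>(v, xs, us). f v (xs j) (us l))
    = expect pV (\<lambda>v. expect (pX v) (\<lambda>x. expect (pU v) (\<lambda>u. f v x u)))"
  using assms
  by (simp add: expect_cloud expect_Pi_component[where h = "\<lambda>u. f _ _ u"]
      expect_Pi_component[where h = "\<lambda>x. expect _ (\<lambda>u. f _ x u)"])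

lemma expect_codebook_component:
  assumes "i < M1"
  shows "expect codebook (\<lambda>B. f (B i)) = expect cloud f"
  unfolding codebook_def using assms by (simp add: expect_Pi_component[where h = f])

lemma codebook_resample:
  assumes "i < M1"
  shows "expect codebook F = expect codebook (\<lambda>B. expect cloud (\<lambda>c. F (B(i := c))))"
  unfolding codebook_def using assms
  by (subst expect_Pi_resample[where k = i]) (auto intro: finite_cloud)

section \<open>Mean contribution of competing codewords\<close>

text \<open>Redrawing cloud i' replaces its contribution by a mean of at most K, and the threshold
  on \<beta> absorbs the M1 - 1 competitors. It serves the relay with K = 1, where a cloud
  contributes the weight of its centre, and the receiver with K = M2 * L, where it contributes all
  its candidates.\<close>

lemma other_clouds_bound:
  assumes i: "i < M1"
    and H: "\<And>c. 0 \<le> H c" and \<beta>: "\<And>c. H c \<noteq> 0 \<Longrightarrow> 0 < \<beta> c \<and> real (M1 - 1) * K \<le> \<epsilon> * \<beta> c"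
    and T: "expect cloud T \<le> K"
  shows "expect codebook (\<lambda>B. H (B i) * (\<Sum>i'\<in>{..<M1} - {i}. T (B i') / \<beta> (B i)))
    \<le> \<epsilon> * expect cloud H"
proof -
  have nn: "0 \<le> H c / \<beta> c" for c
    using H[of c] \<beta>[of c] by (cases "H c = 0") auto
  have "expect codebook (\<lambda>B. H (B i) * (\<Sum>i'\<in>{..<M1} - {i}. T (B i') / \<beta> (B i)))
      = (\<Sum>i'\<in>{..<M1} - {i}. expect codebook (\<lambda>B. H (B i) / \<beta> (B i) * T (B i')))"
    by (subst expect_sum[OF finite_codebook, symmetric]) (simp add: sum_distrib_left)
  also have "\<dots> \<le> (\<Sum>i'\<in>{..<M1} - {i}. expect cloud (\<lambda>c. H c / \<beta> c * K))"
  proof (intro sum_mono)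
    fix i' assume i': "i' \<in> {..<M1} - {i}"
    have "expect codebook (\<lambda>B. H (B i) / \<beta> (B i) * T (B i'))
        = expect codebook (\<lambda>B. H (B i) / \<beta> (B i) * expect cloud T)"
      using i' by (subst codebook_resample[of i']) auto
    also have "\<dots> \<le> expect codebook (\<lambda>B. H (B i) / \<beta> (B i) * K)"
      by (intro expect_mono finite_codebook mult_left_mono T nn)
    also have "\<dots> = expect cloud (\<lambda>c. H c / \<beta> c * K)"
      by (rule expect_codebook_component[OF i])
    finally show "expect codebook (\<lambda>B. H (B i) / \<beta> (B i) * T (B i')) \<le> \<dots>" .
  qed
  also have "\<dots> = expect cloud (\<lambda>c. real (M1 - 1) * (H c / \<beta> c * K))"
    using i by (subst integral_mult_right_zero) simp
  also have "\<dots> \<le> expect cloud (\<lambda>c. \<epsilon> * H c)"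
  proof (intro expect_mono finite_cloud)
    fix c
    show "real (M1 - 1) * (H c / \<beta> c * K) \<le> \<epsilon> * H c"
    proof (cases "H c = 0")
      case False
      with \<beta>[of c] have "real (M1 - 1) * K / \<beta> c \<le> \<epsilon>" by (simp add: pos_divide_le_eq)
      from mult_right_mono[OF this H[of c]] show ?thesis by (simp add: field_simps)
    qed simp
  qed
  also have "\<dots> = \<epsilon> * expect cloud H" by simp
  finally show ?thesis .
qed

text \<open>The true index contributes at most \<epsilon> because its weight is small against L;
  each of the other L - 1 indices contributes a mean of at most 1 / L. Unlike the packing bounds,
  this one wants many codewords.\<close>

lemma covering_load_bound:
  assumes l: "l < L" and h: "\<And>v x u. 0 \<le> h v x u"
    and w: "\<And>v. expect (pU v) (\<lambda>u. w u v) \<le> 1"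
    and hw: "\<And>v x u. h v x u \<noteq> 0 \<Longrightarrow> w u v \<le> \<epsilon> * real L"
  shows "expect cloud (\<lambda>(v, xs, us). h v (xs j) (us l) * ((\<Sum>l'<L. w (us l') v) / real L))
    \<le> (1 + \<epsilon>) * expect cloud (\<lambda>(v, xs, us). h v (xs j) (us l))" (is "_ \<le> _ * ?h")
proof -
  have "expect cloud (\<lambda>(v, xs, us). h v (xs j) (us l) * ((\<Sum>l'<L. w (us l') v) / real L))
      = (\<Sum>l'<L. expect cloud (\<lambda>(v, xs, us). h v (xs j) (us l) * w (us l') v / real L))"
    by (subst expect_sum[OF finite_cloud, symmetric])
       (simp add: sum_distrib_left sum_divide_distrib case_prod_unfold)
  also have "\<dots> = expect cloud (\<lambda>(v, xs, us). h v (xs j) (us l) * w (us l) v / real L)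
      + (\<Sum>l'\<in>{..<L} - {l}. expect cloud (\<lambda>(v, xs, us). h v (xs j) (us l) * w (us l') v / real L))"
    using l by (subst sum.remove[of _ l]) auto
  also have "\<dots> \<le> expect cloud (\<lambda>(v, xs, us). \<epsilon> * h v (xs j) (us l))
      + (\<Sum>l'\<in>{..<L} - {l}. expect cloud (\<lambda>(v, xs, us). h v (xs j) (us l) / real L))"
  proof (intro add_mono sum_mono)
    show "expect cloud (\<lambda>(v, xs, us). h v (xs j) (us l) * w (us l) v / real L)
      \<le> expect cloud (\<lambda>(v, xs, us). \<epsilon> * h v (xs j) (us l))"
    proof (intro expect_mono finite_cloud, clarsimp)
      fix v xs us
      show "h v (xs j) (us l) * w (us l) v / real L \<le> \<epsilon> * h v (xs j) (us l)"
        using hw[of v "xs j" "us l"] h[of v "xs j" "us l"] l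
          mult_left_mono[of "w (us l) v" "\<epsilon> * real L" "h v (xs j) (us l)"]
        by (cases "h v (xs j) (us l) = 0") (auto simp: pos_divide_le_eq mult_ac)
    qed
  next
    fix l' assume l': "l' \<in> {..<L} - {l}"
    have "expect cloud (\<lambda>(v, xs, us). h v (xs j) (us l) * w (us l') v / real L)
        = expect cloud (\<lambda>(v, xs, us). h v (xs j) (us l) * expect (pU v) (\<lambda>u. w u v) / real L)"
      using l' by (subst cloud_resample_u[of l']) auto
    also have "\<dots> \<le> expect cloud (\<lambda>(v, xs, us). h v (xs j) (us l) * 1 / real L)"
      by (intro expect_mono finite_cloud) (auto intro!: divide_right_mono mult_left_le w h)
    finally show "expect cloud (\<lambda>(v, xs, us). h v (xs j) (us l) * w (us l') v / real L)
        \<le> expect cloud (\<lambda>(v, xs, us). h v (xs j) (us l) / real L)" by simp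
  qed
  also have "\<dots> = \<epsilon> * ?h + real (L - 1) / real L * ?h"
    using l by (simp add: case_prod_unfold)
  also have "\<dots> \<le> \<epsilon> * ?h + 1 * ?h"
    by (intro add_left_mono mult_right_mono expect_nonneg) (auto intro: h simp: divide_le_eq_1)
  finally show ?thesis by (simp add: algebra_simps)
qed

text \<open>A wrong \<open>x\<close> paired with the true \<open>u\<close> averages to
  \<open>q1\<close>; a wrong \<open>x\<close> paired with a wrong \<open>u\<close> averages further
  to \<open>q2\<close>. The two cases have separate thresholds, hence 2 * \<epsilon>. Pairs with j'
  = j are absent: the right message with a wrong index is no error.\<close>

lemma same_cloud_bound:
  assumes j: "j < M2" and l: "l < L" and h: "\<And>v x u. 0 \<le> h v x u"
    and q1: "\<And>v u. expect (pX v) (\<lambda>x. q v u x) \<le> q1 v u"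
    and q2: "\<And>v. expect (pU v) (\<lambda>u. q1 v u) \<le> q2 v" and q2_nonneg: "\<And>v. 0 \<le> q2 v"
    and hq: "\<And>v x u. h v x u \<noteq> 0 \<Longrightarrow> 0 < q v u x \<and> real (M2 - 1) * q1 v u \<le> \<epsilon> * q v u x
      \<and> real (M2 - 1) * real L * q2 v \<le> \<epsilon> * q v u x"
  shows "expect cloud (\<lambda>(v, xs, us). h v (xs j) (us l) *
      (\<Sum>j'\<in>{..<M2} - {j}. \<Sum>l'<L. q v (us l') (xs j') / q v (us l) (xs j)))
    \<le> 2 * \<epsilon> * expect cloud (\<lambda>(v, xs, us). h v (xs j) (us l))" (is "_ \<le> _ * ?h")
proof -
  define g where "g v x u = h v x u / q v u x" for v x u
  have g: "0 \<le> g v x u" for v x u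
    using h[of v x u] hq[of v x u] by (cases "h v x u = 0") (auto simp: g_def)
  have g_eq: "g v x u * q v u x = h v x u" for v x u
    using hq[of v x u] by (cases "h v x u = 0") (auto simp: g_def)
  have one: "expect cloud (\<lambda>(v, xs, us). g v (xs j) (us l) * q v (us l) (xs j'))
      \<le> expect cloud (\<lambda>(v, xs, us). g v (xs j) (us l) * q1 v (us l))"
    if "j' \<in> {..<M2} - {j}" for j'
  proof -
    have "expect cloud (\<lambda>(v, xs, us). g v (xs j) (us l) * q v (us l) (xs j'))
       = expect cloud (\<lambda>(v, xs, us). g v (xs j) (us l) * expect (pX v) (\<lambda>x. q v (us l) x))"
      using that by (subst cloud_resample_x[of j']) auto
    also have "\<dots> \<le> expect cloud (\<lambda>(v, xs, us). g v (xs j) (us l) * q1 v (us l))"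
      by (intro expect_mono finite_cloud) (auto intro!: mult_left_mono q1 g)
    finally show ?thesis .
  qed
  have two: "expect cloud (\<lambda>(v, xs, us). g v (xs j) (us l) * q v (us l') (xs j'))
      \<le> expect cloud (\<lambda>(v, xs, us). g v (xs j) (us l) * q2 v)"
    if "j' \<in> {..<M2} - {j}" "l' \<in> {..<L} - {l}" for j' l'
  proof -
    have "expect cloud (\<lambda>(v, xs, us). g v (xs j) (us l) * q v (us l') (xs j'))
       = expect cloud (\<lambda>(v, xs, us). g v (xs j) (us l) * expect (pX v) (\<lambda>x. q v (us l') x))"
      using that by (subst cloud_resample_x[of j']) auto
    also have "\<dots> \<le> expect cloud (\<lambda>(v, xs, us). g v (xs j) (us l) * q1 v (us l'))"
      by (intro expect_mono finite_cloud) (auto intro!: mult_left_mono q1 g)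
    also have "\<dots> = expect cloud (\<lambda>(v, xs, us). g v (xs j) (us l) * expect (pU v) (\<lambda>u. q1 v u))"
      using that by (subst cloud_resample_u[of l']) auto
    also have "\<dots> \<le> expect cloud (\<lambda>(v, xs, us). g v (xs j) (us l) * q2 v)"
      by (intro expect_mono finite_cloud) (auto intro!: mult_left_mono q2 g)
    finally show ?thesis .
  qed
  have "expect cloud (\<lambda>(v, xs, us). h v (xs j) (us l) *
      (\<Sum>j'\<in>{..<M2} - {j}. \<Sum>l'<L. q v (us l') (xs j') / q v (us l) (xs j)))
    = (\<Sum>j'\<in>{..<M2} - {j}. \<Sum>l'<L. expect cloud (\<lambda>(v, xs, us). g v (xs j) (us l) * q v (us l') (xs j')))"
    by (simp add: expect_sum[OF finite_cloud, symmetric] sum_distrib_left case_prod_unfold g_def)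
  also have "\<dots> = (\<Sum>j'\<in>{..<M2} - {j}.
        expect cloud (\<lambda>(v, xs, us). g v (xs j) (us l) * q v (us l) (xs j')) +
        (\<Sum>l'\<in>{..<L} - {l}. expect cloud (\<lambda>(v, xs, us). g v (xs j) (us l) * q v (us l') (xs j'))))"
    using l by (intro sum.cong refl, subst sum.remove[of _ l]) auto
  also have "\<dots> \<le> (\<Sum>j'\<in>{..<M2} - {j}.
        expect cloud (\<lambda>(v, xs, us). g v (xs j) (us l) * q1 v (us l)) +
        (\<Sum>l'\<in>{..<L} - {l}. expect cloud (\<lambda>(v, xs, us). g v (xs j) (us l) * q2 v)))"
    by (intro sum_mono add_mono one two)
  also have "\<dots> = expect cloud (\<lambda>(v, xs, us). g v (xs j) (us l) * (real (M2 - 1) * q1 v (us l)))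
      + expect cloud (\<lambda>(v, xs, us). g v (xs j) (us l) * (real (M2 - 1) * real (L - 1) * q2 v))"
    using j l by (simp add: case_prod_unfold algebra_simps flip: integral_mult_right_zero)
  also have "\<dots> \<le> expect cloud (\<lambda>(v, xs, us). \<epsilon> * h v (xs j) (us l))
      + expect cloud (\<lambda>(v, xs, us). \<epsilon> * h v (xs j) (us l))"
  proof (intro add_mono expect_mono finite_cloud, goal_cases)
    case (1 c)
    obtain v xs us where c: "c = (v, xs, us)" by (cases c)
    show ?case
    proof (cases "h v (xs j) (us l) = 0")
      case False
      with hq[of v "xs j" "us l"] g[of v "xs j" "us l"]
      have "g v (xs j) (us l) * (real (M2 - 1) * q1 v (us l)) \<le> g v (xs j) (us l) * (\<epsilon> * q v (us l) (xs j))"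
        by (intro mult_left_mono) auto
      thus ?thesis using g_eq[of v "xs j" "us l"] by (simp add: c mult_ac)
    qed (simp add: c g_def)
  next
    case (2 c)
    obtain v xs us where c: "c = (v, xs, us)" by (cases c)
    show ?case
    proof (cases "h v (xs j) (us l) = 0")
      case False
      have "real (M2 - 1) * real (L - 1) * q2 v \<le> real (M2 - 1) * real L * q2 v"
        by (intro mult_left_mono mult_right_mono q2_nonneg) auto
      also have "\<dots> \<le> \<epsilon> * q v (us l) (xs j)" using hq False by blast
      finally have "g v (xs j) (us l) * (real (M2 - 1) * real (L - 1) * q2 v)
          \<le> g v (xs j) (us l) * (\<epsilon> * q v (us l) (xs j))"
        using g by (intro mult_left_mono) auto
      thus ?thesis using g_eq[of v "xs j" "us l"] by (simp add: c mult_ac)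
    qed (simp add: c g_def)
  qed
  also have "\<dots> = 2 * \<epsilon> * ?h" by (simp add: case_prod_unfold)
  finally show ?thesis .
qed

text \<open>
  The loads are the normalising sums of the stochastic relay and decoder; if one vanishes, division
  by zero makes the corresponding weights zero, so they still sum to at most one.
\<close>

definition relay_load :: "('v \<Rightarrow> real) \<Rightarrow> (nat \<Rightarrow> 'v \<times> (nat \<Rightarrow> 'x) \<times> (nat \<Rightarrow> 'u)) \<Rightarrow> real" where
  "relay_load \<alpha> B = (\<Sum>i<M1. \<alpha> (fst (B i)))"

definition cover_load :: "('u \<Rightarrow> 'v \<Rightarrow> real) \<Rightarrow> 'v \<times> (nat \<Rightarrow> 'x) \<times> (nat \<Rightarrow> 'u) \<Rightarrow> real" where
  "cover_load w = (\<lambda>(v, xs, us). \<Sum>l<L. w (us l) v)"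

text \<open>Summing over l makes the relay's index a nuisance parameter: the receiver never has to
  identify it.\<close>

definition msg_weight ::
  "('v \<Rightarrow> 'u \<Rightarrow> 'x \<Rightarrow> real) \<Rightarrow> 'v \<times> (nat \<Rightarrow> 'x) \<times> (nat \<Rightarrow> 'u) \<Rightarrow> nat \<Rightarrow> real" where
  "msg_weight q = (\<lambda>(v, xs, us) j. \<Sum>l<L. q v (us l) (xs j))"

definition decoder_load ::
  "('v \<Rightarrow> 'u \<Rightarrow> 'x \<Rightarrow> real) \<Rightarrow> (nat \<Rightarrow> 'v \<times> (nat \<Rightarrow> 'x) \<times> (nat \<Rightarrow> 'u)) \<Rightarrow> real" where
  "decoder_load q B = (\<Sum>i<M1. \<Sum>j<M2. msg_weight q (B i) j)"

text \<open>\<open>h\<close> will be the channel law times the relay's numerator \<open>w\<close>,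
  cut to zero where the thresholds fail, so the thresholds matter only where \<open>h\<close> is
  nonzero. The factor 1 / L is the share of one index and is regained on summing over l. The loss 5
  * \<epsilon> collects one \<epsilon> each from \<open>a\<close>, \<open>b\<close> and
  \<open>c2\<close>, and two from \<open>c1\<close>.\<close>

lemma expected_success_ge:
  assumes i: "i < M1" and j: "j < M2" and l: "l < L"
    and h: "\<And>v x u. 0 \<le> h v x u"
    and \<alpha>: "\<And>v. 0 \<le> \<alpha> v" "expect pV \<alpha> \<le> 1"
    and w: "\<And>v u. 0 \<le> w u v" "\<And>v. expect (pU v) (\<lambda>u. w u v) \<le> 1"
    and q: "\<And>v u x. 0 \<le> q v u x" "\<And>v u. expect (pX v) (\<lambda>x. q v u x) \<le> q1 v u"
      "\<And>v. expect (pU v) (\<lambda>u. q1 v u) \<le> q2 v" "\<And>v. 0 \<le> q2 v" "expect pV q2 \<le> 1"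
    and good: "\<And>v x u. h v x u \<noteq> 0 \<Longrightarrow>
        0 < \<alpha> v \<and> 0 < w u v \<and> 0 < q v u x \<and>
        real (M1 - 1) \<le> \<epsilon> * \<alpha> v \<and>
        w u v \<le> \<epsilon> * real L \<and>
        real (M2 - 1) * q1 v u \<le> \<epsilon> * q v u x \<and>
        real (M2 - 1) * real L * q2 v \<le> \<epsilon> * q v u x \<and>
        real (M1 - 1) * (real M2 * real L) \<le> \<epsilon> * q v u x"
  shows "(1 - 5 * \<epsilon>) / real L * expect pV (\<lambda>v. expect (pX v) (\<lambda>x. expect (pU v) (\<lambda>u. h v x u)))
    \<le> expect codebook (\<lambda>B. case B i of (v, xs, us) \<Rightarrow>
         \<alpha> v / relay_load \<alpha> B * (h v (xs j) (us l) / cover_load w (B i)) *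
         (msg_weight q (B i) j / decoder_load q B))"
    (is "_ \<le> expect codebook ?S")
proof -
  define H where "H = (\<lambda>(v, xs, us). h v (xs j) (us l))"
  have H: "0 \<le> H c" for c by (auto simp: H_def h split: prod.split)
  define Q where "Q = (\<lambda>(v, xs, us). q v (us l) (xs j))"
  \<comment> \<open>Loads on a scale where the ideal value is one: \<open>a\<close> is relative to
    the true centre, \<open>b\<close> to the number of indices, and \<open>c\<close> bounds from
    above the decoder load relative to the weight of the true message.\<close>
  define a where "a B = 1 + (\<Sum>i'\<in>{..<M1} - {i}. \<alpha> (fst (B i')) / \<alpha> (fst (B i)))" for B :: "nat \<Rightarrow> 'v \<times> (nat \<Rightarrow> 'x) \<times> (nat \<Rightarrow> 'u)"
  define b where "b B = cover_load w (B i) / real L" for B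
  define c1 where "c1 = (\<lambda>(v, xs, us). \<Sum>j'\<in>{..<M2} - {j}. \<Sum>l'<L. q v (us l') (xs j') / q v (us l) (xs j))"
  define c2 where "c2 B = (\<Sum>i'\<in>{..<M1} - {i}. (\<Sum>j'<M2. msg_weight q (B i') j') / Q (B i))" for B
  define c where "c B = 1 + c1 (B i) + c2 B" for B

  have Ea: "expect codebook (\<lambda>B. H (B i) * a B) \<le> (1 + \<epsilon>) * expect cloud H"
  proof -
    have "expect cloud (\<lambda>c. \<alpha> (fst c)) \<le> 1"
      using \<alpha>(2) by (simp add: expect_cloud)
    hence "expect codebook (\<lambda>B. H (B i) * (\<Sum>i'\<in>{..<M1} - {i}. \<alpha> (fst (B i')) / \<alpha> (fst (B i)))) \<le> \<epsilon> * expect cloud H"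
      using good by (intro other_clouds_bound[where K = 1] i H) (auto simp: H_def split: prod.splits)
    thus ?thesis
      by (simp add: a_def distrib_left expect_add[OF finite_codebook] expect_codebook_component[OF i] distrib_right)
  qed
  have Eb: "expect codebook (\<lambda>B. H (B i) * b B) \<le> (1 + \<epsilon>) * expect cloud H"
  proof -
    have "expect cloud (\<lambda>c. H c * (cover_load w c / real L)) \<le> (1 + \<epsilon>) * expect cloud H"
      using covering_load_bound[of l h w \<epsilon> j] l h w(2) good
      by (auto simp: H_def cover_load_def case_prod_unfold)
    thus ?thesis
      unfolding b_def by (subst expect_codebook_component[OF i, of "\<lambda>c. H c * (cover_load w c / real L)"])
  qed
  have Ec1: "expect codebook (\<lambda>B. H (B i) * c1 (B i)) \<le> 2 * \<epsilon> * expect cloud H"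
  proof -
    have "expect cloud (\<lambda>c. H c * c1 c) \<le> 2 * \<epsilon> * expect cloud H"
      using same_cloud_bound[of j l h q q1 q2 \<epsilon>] j l h q(2,3,4) good
      by (simp add: H_def c1_def case_prod_unfold)
    thus ?thesis
      by (subst expect_codebook_component[OF i, of "\<lambda>c. H c * c1 c"])
  qed
  have Ec2: "expect codebook (\<lambda>B. H (B i) * c2 B) \<le> \<epsilon> * expect cloud H"
    unfolding c2_def
  proof (rule other_clouds_bound[OF i H])
    show "0 < Q c \<and> real (M1 - 1) * (real M2 * real L) \<le> \<epsilon> * Q c" if "H c \<noteq> 0" for c
      using good that by (auto simp: H_def Q_def split: prod.splits)
    \<comment> \<open>In a foreign cloud all of \<open>x\<close>, \<open>u\<close> and
      \<open>v\<close> are fresh, so each of its M2 * L candidates has mean weight at most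
      one.\<close>
    have "expect cloud (\<lambda>c. \<Sum>j'<M2. msg_weight q c j')
        = (\<Sum>j'<M2. \<Sum>l'<L. expect cloud (\<lambda>(v, xs, us). q v (us l') (xs j')))"
      by (simp add: msg_weight_def case_prod_unfold expect_sum[OF finite_cloud])
    also have "\<dots> \<le> (\<Sum>j'<M2. \<Sum>l'<L. 1)"
    proof (intro sum_mono)
      fix j' l' assume "j' \<in> {..<M2}" "l' \<in> {..<L}"
      hence jl: "j' < M2" "l' < L" by auto
      have "expect cloud (\<lambda>(v, xs, us). q v (us l') (xs j'))
          = expect cloud (\<lambda>(v, xs, us). expect (pX v) (\<lambda>x. q v (us l') x))"
        using jl by (subst cloud_resample_x[of j']) auto
      also have "\<dots> \<le> expect cloud (\<lambda>(v, xs, us). q1 v (us l'))"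
        by (intro expect_mono finite_cloud) (auto intro!: q)
      also have "\<dots> = expect cloud (\<lambda>(v, xs, us). expect (pU v) (\<lambda>u. q1 v u))"
        using jl by (subst cloud_resample_u[of l']) auto
      also have "\<dots> \<le> expect cloud (\<lambda>(v, xs, us). q2 v)"
        by (intro expect_mono finite_cloud) (auto intro!: q)
      also have "\<dots> \<le> 1" using q(5) by (simp add: expect_cloud)
      finally show "expect cloud (\<lambda>(v, xs, us). q v (us l') (xs j')) \<le> 1" .
    qed
    finally show "expect cloud (\<lambda>c. \<Sum>j'<M2. msg_weight q c j') \<le> real M2 * real L" by simp
  qed

  have "(1 - 5 * \<epsilon>) * expect cloud H \<le> expect codebook (\<lambda>B. H (B i) * (4 - a B - b B - c B))"
  proof -
    have "expect codebook (\<lambda>B. H (B i) * (4 - a B - b B - c B))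
       = expect codebook (\<lambda>B. 3 * H (B i)) - expect codebook (\<lambda>B. H (B i) * a B) - expect codebook (\<lambda>B. H (B i) * b B)
          - expect codebook (\<lambda>B. H (B i) * c1 (B i)) - expect codebook (\<lambda>B. H (B i) * c2 B)"
      by (simp only: expect_diff[OF finite_codebook, symmetric])
         (simp add: c_def algebra_simps)
    also have "expect codebook (\<lambda>B. 3 * H (B i)) = 3 * expect cloud H"
      by (simp add: expect_codebook_component[OF i])
    finally show ?thesis using Ea Eb Ec1 Ec2 by (simp add: algebra_simps)
  qed
  also have "\<dots> \<le> expect codebook (\<lambda>B. real L * ?S B)"
  proof (intro expect_mono finite_codebook)
    fix B :: "nat \<Rightarrow> 'v \<times> (nat \<Rightarrow> 'x) \<times> (nat \<Rightarrow> 'u)"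
    obtain v xs us where Bi: "B i = (v, xs, us)" by (cases "B i")
    have m_nonneg: "0 \<le> msg_weight q d j'" for d j'
      by (auto simp: msg_weight_def intro!: sum_nonneg q split: prod.split)
    show "H (B i) * (4 - a B - b B - c B) \<le> real L * ?S B"
    proof (cases "H (B i) = 0")
      case True
      thus ?thesis by (simp add: Bi H_def)
    next
      case False
      hence g: "0 < \<alpha> v" "0 < w (us l) v" "0 < q v (us l) (xs j)"
        using good by (auto simp: Bi H_def)
      have a: "relay_load \<alpha> B = a B * \<alpha> v"
        unfolding relay_load_def a_def using i g
        by (subst sum.remove[of _ i]) (auto simp: Bi distrib_right sum_distrib_right)
      have a_pos: "0 < a B" unfolding a_def by (intro add_pos_nonneg sum_nonneg divide_nonneg_nonneg \<alpha>) simp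
      have b: "cover_load w (B i) = b B * real L" using l by (simp add: b_def)
      have "0 < cover_load w (B i)"
        unfolding cover_load_def Bi using l g w(1) by (auto intro!: sum_pos2[of _ l])
      hence b_pos: "0 < b B" using l by (simp add: b_def)
      let ?q = "q v (us l) (xs j)" and ?s = "msg_weight q (B i) j"
      have c_ge: "0 \<le> c1 (B i)" "0 \<le> c2 B"
        unfolding c1_def c2_def Q_def Bi by (auto intro!: sum_nonneg divide_nonneg_nonneg q m_nonneg)
      have s: "?q \<le> ?s"
        unfolding msg_weight_def Bi using l by (auto intro!: member_le_sum q)
      have "decoder_load q B = ?s + (\<Sum>j'\<in>{..<M2} - {j}. msg_weight q (B i) j')
          + (\<Sum>i'\<in>{..<M1} - {i}. \<Sum>j'<M2. msg_weight q (B i') j')"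
        unfolding decoder_load_def using i j by (simp add: sum.remove[of _ i] sum.remove[of _ j])
      also have "(\<Sum>j'\<in>{..<M2} - {j}. msg_weight q (B i) j') = c1 (B i) * ?q"
        using g by (simp add: c1_def msg_weight_def Bi sum_distrib_right)
      also have "(\<Sum>i'\<in>{..<M1} - {i}. \<Sum>j'<M2. msg_weight q (B i') j') = c2 B * ?q"
        using g by (simp add: c2_def Q_def Bi flip: sum_divide_distrib)
      finally have d: "decoder_load q B = ?s + (c1 (B i) + c2 B) * ?q" by (simp add: algebra_simps)
      have c_pos: "0 < c B" using c_ge by (simp add: c_def)
      \<comment> \<open>The weight \<open>?s\<close> of the true message contains \<open>?q\<close>
        and the nonnegative terms of its other indices. The competitors were measured against
        \<open>?q\<close>; measuring them against \<open>?s\<close> only enlarges the bound on the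
        load, as a lower bound on the share of the true message requires.\<close>
      have "?q * (c1 (B i) + c2 B) \<le> ?s * (c1 (B i) + c2 B)"
        using s c_ge by (intro mult_right_mono) auto
      hence "decoder_load q B \<le> ?s * c B"
        unfolding d c_def by (simp add: algebra_simps)
      moreover have "0 < decoder_load q B"
        unfolding d using g s c_ge by (intro add_pos_nonneg) auto
      ultimately have dc: "1 / c B \<le> ?s / decoder_load q B"
        using c_pos by (simp add: divide_simps mult_ac)
      have "H (B i) * (4 - a B - b B - c B) \<le> H (B i) * (1 / (a B * b B * c B))"
        by (intro mult_left_mono inverse_mult3_ge a_pos b_pos c_pos H)
      also have "\<dots> = 1 / a B * (H (B i) / b B) * (1 / c B)" by simp
      also have "\<dots> \<le> 1 / a B * (H (B i) / b B) * (?s / decoder_load q B)"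
        using a_pos b_pos H[of "B i"] by (intro mult_left_mono dc) auto
      also have "\<dots> = real L * ?S B"
        using g l by (simp add: a b[unfolded Bi] Bi H_def)
      finally show ?thesis .
    qed
  qed
  also have "\<dots> = real L * expect codebook ?S" by simp
  finally have "(1 - 5 * \<epsilon>) * expect cloud H \<le> real L * expect codebook ?S" .
  hence "(1 - 5 * \<epsilon>) / real L * expect cloud H \<le> expect codebook ?S"
    using l by (simp add: field_simps)
  thus ?thesis using expect_cloud_marginal[OF j l, of h] by (simp add: H_def)
qed

text \<open>
  The message is numbered row by row in the M1 by M2 array of (cloud, satellite) pairs, and only the
  first M entries are used. Counting a wrong cloud at the relay that still leads to correct
  decoding only helps.
\<close>

theorem one_shot_code:
  fixes P2 :: "'x \<Rightarrow> 'y2 \<Rightarrow> real" and P3 :: "'x \<Rightarrow> 'u \<Rightarrow> 'v \<Rightarrow> 'y2 \<Rightarrow> 'y3 \<Rightarrow> real"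
    and \<alpha> :: "'y2 \<Rightarrow> 'v \<Rightarrow> real" and w :: "'y2 \<Rightarrow> 'u \<Rightarrow> 'v \<Rightarrow> real"
    and q :: "'y3 \<Rightarrow> 'v \<Rightarrow> 'u \<Rightarrow> 'x \<Rightarrow> real"
    and G :: "'v \<Rightarrow> 'x \<Rightarrow> 'u \<Rightarrow> 'y2 \<Rightarrow> 'y3 \<Rightarrow> bool"
  assumes A: "finite A2" "finite A3" and M: "1 \<le> M" "M \<le> M1 * M2" and L: "1 \<le> L"
    and P2: "\<And>x y2. 0 \<le> P2 x y2" and P3: "\<And>x u v y2 y3. 0 \<le> P3 x u v y2 y3"
    and \<alpha>: "\<And>y2 v. 0 \<le> \<alpha> y2 v" "\<And>y2. expect pV (\<alpha> y2) \<le> 1"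
    and w: "\<And>y2 v u. 0 \<le> w y2 u v" "\<And>y2 v. expect (pU v) (\<lambda>u. w y2 u v) \<le> 1"
    and q: "\<And>y3 v u x. 0 \<le> q y3 v u x" "\<And>y3 v u. expect (pX v) (\<lambda>x. q y3 v u x) \<le> q1 y3 v u"
      "\<And>y3 v. expect (pU v) (\<lambda>u. q1 y3 v u) \<le> q2 y3 v" "\<And>y3 v. 0 \<le> q2 y3 v"
      "\<And>y3. expect pV (q2 y3) \<le> 1"
    and good: "\<And>v x u y2 y3. G v x u y2 y3 \<Longrightarrow>
        0 < \<alpha> y2 v \<and> 0 < w y2 u v \<and> 0 < q y3 v u x \<and>
        real (M1 - 1) \<le> \<epsilon> * \<alpha> y2 v \<and>
        w y2 u v \<le> \<epsilon> * real L \<and>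
        real (M2 - 1) * q1 y3 v u \<le> \<epsilon> * q y3 v u x \<and>
        real (M2 - 1) * real L * q2 y3 v \<le> \<epsilon> * q y3 v u x \<and>
        real (M1 - 1) * (real M2 * real L) \<le> \<epsilon> * q y3 v u x"
  shows "\<exists>enc relay dec.
    (1 - 5 * \<epsilon>) * (\<Sum>y2\<in>A2. \<Sum>y3\<in>A3. expect pV (\<lambda>v. expect (pX v) (\<lambda>x. expect (pU v) (\<lambda>u.
        if G v x u y2 y3 then P2 x y2 * w y2 u v * P3 x u v y2 y3 else 0))))
    \<le> (1 / real M) * (\<Sum>m\<in>{1..M}. \<Sum>y2\<in>A2. \<Sum>y3\<in>A3.
        P2 (enc m) y2 * P3 (enc m) (fst (relay y2)) (snd (relay y2)) y2 y3 *
        (if dec y3 = Some m then 1 else 0))"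
proof -
  define h where "h y2 y3 v x u = (if G v x u y2 y3 then P2 x y2 * w y2 u v * P3 x u v y2 y3 else 0)"
    for y2 y3 v x u
  define Eh where "Eh y2 y3 = expect pV (\<lambda>v. expect (pX v) (\<lambda>x. expect (pU v) (\<lambda>u. h y2 y3 v x u)))"
    for y2 y3
  define fi fj where "fi m = (m - 1) div M2" and "fj m = (m - 1) mod M2" for m
  have M2: "0 < M2" using M by (cases M2) auto
  have fij: "fi m < M1 \<and> fj m < M2" if "m \<in> {1..M}" for m
    using that M M2 by (auto simp: fi_def fj_def div_less_iff_less_mult)
  have inj: "inj_on (\<lambda>m. (fi m, fj m)) {1..M}"
  proof (rule inj_onI)
    fix m m' assume m: "m \<in> {1..M}" "m' \<in> {1..M}" and "(fi m, fj m) = (fi m', fj m')"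
    hence "(m - 1) div M2 * M2 + (m - 1) mod M2 = (m' - 1) div M2 * M2 + (m' - 1) mod M2"
      by (simp add: fi_def fj_def)
    thus "m = m'" using m by (auto simp del: mod_mult_div_eq)
  qed
  define X where "X B m = fst (snd (B (fi m))) (fj m)" for B :: "nat \<Rightarrow> 'v \<times> (nat \<Rightarrow> 'x) \<times> (nat \<Rightarrow> 'u)" and m
  define V where "V B i = fst (B i)" for B :: "nat \<Rightarrow> 'v \<times> (nat \<Rightarrow> 'x) \<times> (nat \<Rightarrow> 'u)" and i :: nat
  define U where "U B i l = snd (snd (B i)) l" for B :: "nat \<Rightarrow> 'v \<times> (nat \<Rightarrow> 'x) \<times> (nat \<Rightarrow> 'u)" and i l :: nat
  define Rel where "Rel B y2 = (\<lambda>(i, l). \<alpha> y2 (V B i) / relay_load (\<alpha> y2) B *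
      (w y2 (U B i l) (V B i) / cover_load (w y2) (B i)))" for B y2
  define Dec where "Dec B y3 = (\<lambda>(i, j). msg_weight (q y3) (B i) j / decoder_load (q y3) B)" for B y3
  have load_nonneg: "0 \<le> relay_load (\<alpha> y2) B" "0 \<le> cover_load (w y2) c" "0 \<le> msg_weight (q y3) c j"
    "0 \<le> decoder_load (q y3) B" for y2 y3 B c j
    by (auto simp: relay_load_def cover_load_def msg_weight_def decoder_load_def
        intro!: sum_nonneg \<alpha> w q split: prod.split)
  have Rel_nonneg: "0 \<le> Rel B y2 k" for B y2 k
    by (auto simp: Rel_def split: prod.split intro!: divide_nonneg_nonneg mult_nonneg_nonneg load_nonneg \<alpha> w)
  have Dec_nonneg: "0 \<le> Dec B y3 k" for B y3 k
    by (auto simp: Dec_def split: prod.split intro!: divide_nonneg_nonneg load_nonneg)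
  have Rel_sum: "(\<Sum>k\<in>{..<M1} \<times> {..<L}. Rel B y2 k) \<le> 1" for B y2
  proof -
    have "(\<Sum>k\<in>{..<M1} \<times> {..<L}. Rel B y2 k)
        = (\<Sum>i<M1. \<alpha> y2 (V B i) / relay_load (\<alpha> y2) B *
            (\<Sum>l<L. w y2 (U B i l) (V B i) / cover_load (w y2) (B i)))"
      by (simp add: Rel_def sum.cartesian_product[symmetric] sum_distrib_left)
    also have "\<dots> \<le> (\<Sum>i<M1. \<alpha> y2 (V B i) / relay_load (\<alpha> y2) B * 1)"
      by (intro sum_mono mult_left_mono divide_nonneg_nonneg load_nonneg \<alpha>)
         (auto simp: cover_load_def U_def V_def case_prod_unfold intro: sum_divide_sum_le_1)
    also have "\<dots> \<le> 1" by (simp add: relay_load_def V_def sum_divide_sum_le_1)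
    finally show ?thesis .
  qed
  have Dec_sum: "(\<Sum>m\<in>{1..M}. Dec B y3 (fi m, fj m)) \<le> 1" for B y3
  proof -
    have "(\<Sum>m\<in>{1..M}. Dec B y3 (fi m, fj m)) = (\<Sum>k\<in>(\<lambda>m. (fi m, fj m)) ` {1..M}. Dec B y3 k)"
      by (subst sum.reindex[OF inj]) simp
    also have "\<dots> \<le> (\<Sum>k\<in>{..<M1} \<times> {..<M2}. Dec B y3 k)"
      using fij by (intro sum_mono2 Dec_nonneg) auto
    also have "\<dots> = (\<Sum>k\<in>{..<M1} \<times> {..<M2}. (\<lambda>(i, j). msg_weight (q y3) (B i) j) k /
        (\<Sum>k\<in>{..<M1} \<times> {..<M2}. (\<lambda>(i, j). msg_weight (q y3) (B i) j) k))"
      by (intro sum.cong) (auto simp: Dec_def decoder_load_def sum.cartesian_product)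
    also have "\<dots> \<le> 1" by (rule sum_divide_sum_le_1)
    finally show ?thesis .
  qed

  define F where "F B = (\<Sum>m\<in>{1..M}. \<Sum>y2\<in>A2. \<Sum>y3\<in>A3. \<Sum>l<L.
      Rel B y2 (fi m, l) * (P2 (X B m) y2 * P3 (X B m) (U B (fi m) l) (V B (fi m)) y2 y3) *
      Dec B y3 (fi m, fj m))" for B
  have "real M * ((1 - 5 * \<epsilon>) * (\<Sum>y2\<in>A2. \<Sum>y3\<in>A3. Eh y2 y3))
      = (\<Sum>m\<in>{1..M}. \<Sum>y2\<in>A2. \<Sum>y3\<in>A3. \<Sum>l<L. (1 - 5 * \<epsilon>) / real L * Eh y2 y3)"
    using L by (simp add: sum_distrib_left)
  also have "\<dots> \<le> (\<Sum>m\<in>{1..M}. \<Sum>y2\<in>A2. \<Sum>y3\<in>A3. \<Sum>l<L.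
      expect codebook (\<lambda>B. Rel B y2 (fi m, l) *
        (P2 (X B m) y2 * P3 (X B m) (U B (fi m) l) (V B (fi m)) y2 y3) * Dec B y3 (fi m, fj m)))"
  proof (intro sum_mono)
    fix m y2 y3 l assume m: "m \<in> {1..M}" and l: "l \<in> {..<L}"
    have h_nonneg: "0 \<le> h y2 y3 v x u" for v x u
      by (auto simp: h_def intro!: mult_nonneg_nonneg P2 P3 w)
    have "(1 - 5 * \<epsilon>) / real L * Eh y2 y3
      \<le> expect codebook (\<lambda>B. case B (fi m) of (v, xs, us) \<Rightarrow>
         \<alpha> y2 v / relay_load (\<alpha> y2) B * (h y2 y3 v (xs (fj m)) (us l) / cover_load (w y2) (B (fi m))) *
         (msg_weight (q y3) (B (fi m)) (fj m) / decoder_load (q y3) B))"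
      unfolding Eh_def
      by (rule expected_success_ge[where ?q1.0 = "q1 y3" and ?q2.0 = "q2 y3"])
         (use m l fij good in \<open>auto simp: \<alpha> w q P2 P3 h_def split: if_splits intro!: mult_nonneg_nonneg\<close>)
    also have "\<dots> \<le> expect codebook (\<lambda>B. Rel B y2 (fi m, l) *
        (P2 (X B m) y2 * P3 (X B m) (U B (fi m) l) (V B (fi m)) y2 y3) * Dec B y3 (fi m, fj m))"
    proof (intro expect_mono finite_codebook)
      fix B :: "nat \<Rightarrow> 'v \<times> (nat \<Rightarrow> 'x) \<times> (nat \<Rightarrow> 'u)"
      obtain v xs us where B: "B (fi m) = (v, xs, us)" by (cases "B (fi m)")
      have "h y2 y3 v (xs (fj m)) (us l)
          \<le> w y2 (us l) v * (P2 (xs (fj m)) y2 * P3 (xs (fj m)) (us l) v y2 y3)"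
        by (auto simp: h_def mult_ac intro!: mult_nonneg_nonneg P2 P3 w)
      hence "\<alpha> y2 v / relay_load (\<alpha> y2) B * (h y2 y3 v (xs (fj m)) (us l) / cover_load (w y2) (B (fi m))) *
         (msg_weight (q y3) (B (fi m)) (fj m) / decoder_load (q y3) B)
        \<le> \<alpha> y2 v / relay_load (\<alpha> y2) B * (w y2 (us l) v * (P2 (xs (fj m)) y2 * P3 (xs (fj m)) (us l) v y2 y3)
           / cover_load (w y2) (B (fi m))) * (msg_weight (q y3) (B (fi m)) (fj m) / decoder_load (q y3) B)"
        by (intro mult_right_mono mult_left_mono divide_right_mono divide_nonneg_nonneg load_nonneg \<alpha>)
      thus "(case B (fi m) of (v, xs, us) \<Rightarrow>
         \<alpha> y2 v / relay_load (\<alpha> y2) B * (h y2 y3 v (xs (fj m)) (us l) / cover_load (w y2) (B (fi m))) *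
         (msg_weight (q y3) (B (fi m)) (fj m) / decoder_load (q y3) B))
        \<le> Rel B y2 (fi m, l) *
        (P2 (X B m) y2 * P3 (X B m) (U B (fi m) l) (V B (fi m)) y2 y3) * Dec B y3 (fi m, fj m)"
        by (simp add: B Rel_def Dec_def X_def U_def V_def mult_ac)
    qed
    finally show "(1 - 5 * \<epsilon>) / real L * Eh y2 y3 \<le> \<dots>" .
  qed
  also have "\<dots> = expect codebook F"
    unfolding F_def by (simp only: expect_sum[OF finite_codebook])
  finally have EF: "real M * ((1 - 5 * \<epsilon>) * (\<Sum>y2\<in>A2. \<Sum>y3\<in>A3. Eh y2 y3)) \<le> expect codebook F" .
  obtain B where B: "expect codebook F \<le> F B" using ex_ge_expect[OF finite_codebook] by blast
  \<comment> \<open>For a fixed codebook, success is linear in the relay's weights for each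
    \<open>y2\<close> separately, and \<Phi> is the coefficient of choice k while the decoder is
    still stochastic. A maximiser can thus be picked for every \<open>y2\<close>
    independently.\<close>
  define \<Phi> where "\<Phi> y2 k = (\<Sum>m\<in>{1..M}. \<Sum>y3\<in>A3.
      P2 (X B m) y2 * P3 (X B m) (U B (fst k) (snd k)) (V B (fst k)) y2 y3 * Dec B y3 (fi m, fj m))" for y2 k
  have \<Phi>_nonneg: "0 \<le> \<Phi> y2 k" for y2 k
    unfolding \<Phi>_def by (intro sum_nonneg mult_nonneg_nonneg P2 P3 Dec_nonneg)
  note EF
  also note B
  also have "F B \<le> (\<Sum>y2\<in>A2. \<Sum>k\<in>{..<M1} \<times> {..<L}. Rel B y2 k * \<Phi> y2 k)"
  proof -
    define t where "t m y2 y3 k = Rel B y2 k *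
      (P2 (X B m) y2 * P3 (X B m) (U B (fst k) (snd k)) (V B (fst k)) y2 y3 * Dec B y3 (fi m, fj m))" for m y2 y3 k
    have "F B = (\<Sum>m\<in>{1..M}. \<Sum>y2\<in>A2. \<Sum>y3\<in>A3. \<Sum>l<L. t m y2 y3 (fi m, l))"
      by (simp add: F_def t_def mult.assoc)
    also have "\<dots> = (\<Sum>m\<in>{1..M}. \<Sum>y2\<in>A2. \<Sum>y3\<in>A3. \<Sum>k\<in>{fi m} \<times> {..<L}. t m y2 y3 k)"
      by (simp add: sum.cartesian_product')
    also have "\<dots> \<le> (\<Sum>m\<in>{1..M}. \<Sum>y2\<in>A2. \<Sum>y3\<in>A3. \<Sum>k\<in>{..<M1} \<times> {..<L}. t m y2 y3 k)"
    proof (intro sum_mono sum_mono2)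
      show "0 \<le> t m y2 y3 k" for m y2 y3 k
        unfolding t_def by (intro mult_nonneg_nonneg Rel_nonneg Dec_nonneg P2 P3)
    qed (use fij in auto)
    also have "\<dots> = (\<Sum>y2\<in>A2. \<Sum>k\<in>{..<M1} \<times> {..<L}. \<Sum>m\<in>{1..M}. \<Sum>y3\<in>A3. t m y2 y3 k)"
      by (subst sum.swap) (rule sum.cong[OF refl], rule sum_swap3)
    finally show ?thesis by (simp only: t_def \<Phi>_def sum_distrib_left)
  qed
  finally have success_soft_relay: "real M * ((1 - 5 * \<epsilon>) * (\<Sum>y2\<in>A2. \<Sum>y3\<in>A3. Eh y2 y3)) \<le> \<dots>" .
  have "\<exists>k'\<in>{..<M1} \<times> {..<L}. (\<Sum>k\<in>{..<M1} \<times> {..<L}. Rel B y2 k * \<Phi> y2 k) \<le> \<Phi> y2 k'" for y2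
    using fij[of 1] M L
    by (intro ex_ge_weighted_sum Rel_nonneg Rel_sum \<Phi>_nonneg) (auto simp: lessThan_empty_iff)
  then obtain r where r: "\<And>y2. (\<Sum>k\<in>{..<M1} \<times> {..<L}. Rel B y2 k * \<Phi> y2 k) \<le> \<Phi> y2 (r y2)"
    by metis
  define relay where "relay y2 = (U B (fst (r y2)) (snd (r y2)), V B (fst (r y2)))" for y2
  \<comment> \<open>Once the relay is deterministic, success is linear in the decoder's weights for
    each \<open>y3\<close>, with coefficient \<Psi>, and the same selection applies.\<close>
  define \<Psi> where "\<Psi> y3 m = (\<Sum>y2\<in>A2. P2 (X B m) y2 *
      P3 (X B m) (fst (relay y2)) (snd (relay y2)) y2 y3)" for y3 m
  have \<Psi>_nonneg: "0 \<le> \<Psi> y3 m" for y3 m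
    unfolding \<Psi>_def by (intro sum_nonneg mult_nonneg_nonneg P2 P3)
  note success_soft_relay
  also have "(\<Sum>y2\<in>A2. \<Sum>k\<in>{..<M1} \<times> {..<L}. Rel B y2 k * \<Phi> y2 k) \<le> (\<Sum>y2\<in>A2. \<Phi> y2 (r y2))"
    by (intro sum_mono r)
  also have "\<dots> = (\<Sum>y3\<in>A3. \<Sum>m\<in>{1..M}. Dec B y3 (fi m, fj m) * \<Psi> y3 m)"
  proof -
    show ?thesis unfolding \<Phi>_def \<Psi>_def by (subst sum.swap, subst sum_swap3) (simp add: sum_distrib_left mult_ac relay_def)
  qed
  finally have success_soft: "real M * ((1 - 5 * \<epsilon>) * (\<Sum>y2\<in>A2. \<Sum>y3\<in>A3. Eh y2 y3)) \<le> \<dots>" .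
  have "\<exists>m'\<in>{1..M}. (\<Sum>m\<in>{1..M}. Dec B y3 (fi m, fj m) * \<Psi> y3 m) \<le> \<Psi> y3 m'" for y3
    using M by (intro ex_ge_weighted_sum Dec_sum Dec_nonneg \<Psi>_nonneg) auto
  then obtain d where d: "\<And>y3. d y3 \<in> {1..M}"
      "\<And>y3. (\<Sum>m\<in>{1..M}. Dec B y3 (fi m, fj m) * \<Psi> y3 m) \<le> \<Psi> y3 (d y3)"
    by metis
  note success_soft
  also have "(\<Sum>y3\<in>A3. \<Sum>m\<in>{1..M}. Dec B y3 (fi m, fj m) * \<Psi> y3 m) \<le> (\<Sum>y3\<in>A3. \<Psi> y3 (d y3))"
    by (intro sum_mono d)
  also have "\<dots> = (\<Sum>y3\<in>A3. \<Sum>m\<in>{1..M}. if m = d y3 then \<Psi> y3 m else 0)"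
    using d(1) by (intro sum.cong refl) (simp add: sum.delta)
  also have "\<dots> = (\<Sum>m\<in>{1..M}. \<Sum>y3\<in>A3. \<Sum>y2\<in>A2.
        P2 (X B m) y2 * P3 (X B m) (fst (relay y2)) (snd (relay y2)) y2 y3 *
        (if Some (d y3) = Some m then 1 else 0))"
    by (subst sum.swap, intro sum.cong refl) (auto simp: \<Psi>_def)
  also have "\<dots> = (\<Sum>m\<in>{1..M}. \<Sum>y2\<in>A2. \<Sum>y3\<in>A3.
        P2 (X B m) y2 * P3 (X B m) (fst (relay y2)) (snd (relay y2)) y2 y3 *
        (if Some (d y3) = Some m then 1 else 0))"
    by (intro sum.cong refl sum.swap)
  finally have "real M * ((1 - 5 * \<epsilon>) * (\<Sum>y2\<in>A2. \<Sum>y3\<in>A3. Eh y2 y3))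
     \<le> (\<Sum>m\<in>{1..M}. \<Sum>y2\<in>A2. \<Sum>y3\<in>A3.
        P2 (X B m) y2 * P3 (X B m) (fst (relay y2)) (snd (relay y2)) y2 y3 *
        (if Some (d y3) = Some m then 1 else 0))" .
  hence "(1 - 5 * \<epsilon>) * (\<Sum>y2\<in>A2. \<Sum>y3\<in>A3. Eh y2 y3)
     \<le> (1 / real M) * (\<Sum>m\<in>{1..M}. \<Sum>y2\<in>A2. \<Sum>y3\<in>A3.
        P2 (X B m) y2 * P3 (X B m) (fst (relay y2)) (snd (relay y2)) y2 y3 *
        (if Some (d y3) = Some m then 1 else 0))"
    using M by (simp add: pos_le_divide_eq mult_ac)
  thus ?thesis
    unfolding Eh_def h_def by (intro exI[of _ "X B"] exI[of _ relay] exI[of _ "\<lambda>y3. Some (d y3)"])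
qed

end

section \<open>Block codes for the relay channel\<close>

definition fV :: "'v \<times> 'x1 \<times> 'y2 \<times> 'u \<times> 'x2 \<times> 'y3 \<Rightarrow> 'v" where
  "fV = (\<lambda>(v, x1, y2, u, x2, y3). v)"
definition fX1 :: "'v \<times> 'x1 \<times> 'y2 \<times> 'u \<times> 'x2 \<times> 'y3 \<Rightarrow> 'x1" where
  "fX1 = (\<lambda>(v, x1, y2, u, x2, y3). x1)"
definition fY2 :: "'v \<times> 'x1 \<times> 'y2 \<times> 'u \<times> 'x2 \<times> 'y3 \<Rightarrow> 'y2" where
  "fY2 = (\<lambda>(v, x1, y2, u, x2, y3). y2)"
definition fU :: "'v \<times> 'x1 \<times> 'y2 \<times> 'u \<times> 'x2 \<times> 'y3 \<Rightarrow> 'u" where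
  "fU = (\<lambda>(v, x1, y2, u, x2, y3). u)"
definition fY3 :: "'v \<times> 'x1 \<times> 'y2 \<times> 'u \<times> 'x2 \<times> 'y3 \<Rightarrow> 'y3" where
  "fY3 = (\<lambda>(v, x1, y2, u, x2, y3). y3)"

lemma coord_simps [simp]:
  "fV (v, x, y2, u, x2, y3) = v" "fX1 (v, x, y2, u, x2, y3) = x" "fY2 (v, x, y2, u, x2, y3) = y2"
  "fU (v, x, y2, u, x2, y3) = u" "fY3 (v, x, y2, u, x2, y3) = y3"
  by (simp_all add: fV_def fX1_def fY2_def fU_def fY3_def)

locale relay_scheme =
  fixes W2 :: "'x1::finite \<Rightarrow> 'y2::finite pmf"
    and W3 :: "'x1 \<Rightarrow> 'x2::finite \<Rightarrow> 'y2 \<Rightarrow> 'y3::finite pmf"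
    and pV :: "'v::finite pmf" and pX :: "'v \<Rightarrow> 'x1 pmf"
    and pU :: "'v \<Rightarrow> 'y2 \<Rightarrow> 'u::finite pmf"
    and x2f :: "'u \<Rightarrow> 'v \<Rightarrow> 'y2 \<Rightarrow> 'x2"
begin

definition J :: "('v \<times> 'x1 \<times> 'y2 \<times> 'u \<times> 'x2 \<times> 'y3) pmf" where
  "J = relay_joint (bind_pmf pV (\<lambda>v. map_pmf (Pair v) (pX v))) W2 pU x2f W3"

text \<open>The conditional law p(u|v) induced by the scheme, from which satellites \<open>u\<close>
  are drawn in ignorance of \<open>x\<close> and \<open>y2\<close>.\<close>

definition pUV :: "'v \<Rightarrow> 'u pmf" where
  "pUV v = bind_pmf (pX v) (\<lambda>x. bind_pmf (W2 x) (\<lambda>y2. pU v y2))"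

abbreviation pr :: "('v \<times> 'x1 \<times> 'y2 \<times> 'u \<times> 'x2 \<times> 'y3 \<Rightarrow> bool) \<Rightarrow> real" where
  "pr Q \<equiv> measure_pmf.prob J {\<omega>. Q \<omega>}"

lemma expect_J:
  "expect J f = expect pV (\<lambda>v. expect (pX v) (\<lambda>x. expect (W2 x) (\<lambda>y2. expect (pU v y2) (\<lambda>u.
     expect (W3 x (x2f u v y2) y2) (\<lambda>y3. f (v, x, y2, u, x2f u v y2, y3))))))"
  by (simp add: J_def relay_joint_def bind_assoc_pmf expect_bind bind_map_pmf)

section \<open>Marginals of the single-letter joint law\<close>

lemma pr_V: "pr (\<lambda>\<omega>. fV \<omega> = v) = pmf pV v"
  by (simp add: prob_eq_expect expect_J expect_single)

lemma pr_XV: "pr (\<lambda>\<omega>. fX1 \<omega> = x \<and> fV \<omega> = v) = pmf pV v * pmf (pX v) x"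
proof -
  have "pr (\<lambda>\<omega>. fX1 \<omega> = x \<and> fV \<omega> = v)
      = expect pV (\<lambda>v'. expect (pX v') (\<lambda>x'. if x' = x \<and> v' = v then 1 else 0))"
    by (simp add: prob_eq_expect expect_J)
  also have "\<dots> = expect pV (\<lambda>v'. if v' = v then pmf (pX v) x else 0)"
    by (intro expect_cong) (simp add: expect_single if_conn)
  finally show ?thesis by (simp add: expect_single)
qed

lemma pr_UV: "pr (\<lambda>\<omega>. fU \<omega> = u \<and> fV \<omega> = v) = pmf pV v * pmf (pUV v) u"
proof -
  have "pr (\<lambda>\<omega>. fU \<omega> = u \<and> fV \<omega> = v)
      = expect pV (\<lambda>v'. expect (pUV v') (\<lambda>u'. if u' = u \<and> v' = v then 1 else 0))"
    by (simp add: prob_eq_expect expect_J pUV_def expect_bind)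
  also have "\<dots> = expect pV (\<lambda>v'. if v' = v then pmf (pUV v) u else 0)"
    by (intro expect_cong) (simp add: expect_single if_conn)
  finally show ?thesis by (simp add: expect_single)
qed

text \<open>The law of \<open>u\<close> sees \<open>x\<close> only through \<open>y2\<close>, so
  p(u|v,y2) is \<open>pU v y2\<close> itself. This is what identifies \<open>w\<close> as the
  density of I(U;Y2|V).\<close>

lemma pr_UY2V:
  "pr (\<lambda>\<omega>. fU \<omega> = u \<and> fY2 \<omega> = y2 \<and> fV \<omega> = v) = pr (\<lambda>\<omega>. fY2 \<omega> = y2 \<and> fV \<omega> = v) * pmf (pU v y2) u"
proof -
  have "pr (\<lambda>\<omega>. fU \<omega> = u \<and> fY2 \<omega> = y2 \<and> fV \<omega> = v)
      = expect pV (\<lambda>v'. expect (pX v') (\<lambda>x. expect (W2 x) (\<lambda>y2'. expect (pU v' y2')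
         (\<lambda>u'. if u' = u \<and> y2' = y2 \<and> v' = v then 1 else 0))))"
    by (simp add: prob_eq_expect expect_J)
  also have "\<dots> = expect pV (\<lambda>v'. expect (pX v') (\<lambda>x. expect (W2 x) (\<lambda>y2'.
         (if y2' = y2 \<and> v' = v then 1 else 0) * pmf (pU v y2) u)))"
    by (intro expect_cong) (simp add: expect_single if_conn)
  also have "\<dots> = pr (\<lambda>\<omega>. fY2 \<omega> = y2 \<and> fV \<omega> = v) * pmf (pU v y2) u"
    by (simp add: prob_eq_expect expect_J)
  finally show ?thesis .
qed

text \<open>
  Densities of the joint law with respect to the codebook laws. The ratios \<open>q / q1\<close>, \<open>q1 / q2\<close> and \<open>q1\<close>
  are the densities of I(X1;U,Y3|V), I(U;Y3|V) and I(V,U;Y3).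
\<close>

definition \<alpha> :: "'y2 \<Rightarrow> 'v \<Rightarrow> real" where
  "\<alpha> y2 v = pr (\<lambda>\<omega>. fV \<omega> = v \<and> fY2 \<omega> = y2) / (pr (\<lambda>\<omega>. fV \<omega> = v) * pr (\<lambda>\<omega>. fY2 \<omega> = y2))"

definition w :: "'y2 \<Rightarrow> 'u \<Rightarrow> 'v \<Rightarrow> real" where
  "w y2 u v = pmf (pU v y2) u / pmf (pUV v) u"

definition q :: "'y3 \<Rightarrow> 'v \<Rightarrow> 'u \<Rightarrow> 'x1 \<Rightarrow> real" where
  "q y3 v u x = pr (\<lambda>\<omega>. fX1 \<omega> = x \<and> fU \<omega> = u \<and> fY3 \<omega> = y3 \<and> fV \<omega> = v) * pr (\<lambda>\<omega>. fV \<omega> = v)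
     / (pr (\<lambda>\<omega>. fU \<omega> = u \<and> fV \<omega> = v) * pr (\<lambda>\<omega>. fY3 \<omega> = y3) * pr (\<lambda>\<omega>. fX1 \<omega> = x \<and> fV \<omega> = v))"

definition q1 :: "'y3 \<Rightarrow> 'v \<Rightarrow> 'u \<Rightarrow> real" where
  "q1 y3 v u = pr (\<lambda>\<omega>. fU \<omega> = u \<and> fY3 \<omega> = y3 \<and> fV \<omega> = v)
     / (pr (\<lambda>\<omega>. fU \<omega> = u \<and> fV \<omega> = v) * pr (\<lambda>\<omega>. fY3 \<omega> = y3))"

definition q2 :: "'y3 \<Rightarrow> 'v \<Rightarrow> real" where
  "q2 y3 v = pr (\<lambda>\<omega>. fY3 \<omega> = y3 \<and> fV \<omega> = v) / (pr (\<lambda>\<omega>. fV \<omega> = v) * pr (\<lambda>\<omega>. fY3 \<omega> = y3))"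

lemma density_nonneg: "0 \<le> \<alpha> y2 v" "0 \<le> w y2 u v" "0 \<le> q y3 v u x" "0 \<le> q1 y3 v u" "0 \<le> q2 y3 v"
  by (simp_all add: \<alpha>_def w_def q_def q1_def q2_def)

section \<open>Densities average to at most one\<close>

text \<open>A density relative to the law of an unrelated codeword has mean one, up to division by
  zero: an impossible \<open>y2\<close> gives 0, hence the inequality.\<close>

lemma expect_\<alpha>: "expect pV (\<alpha> y2) \<le> 1"
proof -
  have "expect pV (\<alpha> y2) = (\<Sum>v\<in>UNIV. pr (\<lambda>\<omega>. fV \<omega> = v) * \<alpha> y2 v)"
    by (simp add: expect_UNIV pr_V)
  also have "\<dots> \<le> (\<Sum>v\<in>UNIV. pr (\<lambda>\<omega>. fV \<omega> = v \<and> fY2 \<omega> = y2) / pr (\<lambda>\<omega>. fY2 \<omega> = y2))"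
    by (intro sum_mono) (simp add: \<alpha>_def)
  also have "\<dots> \<le> 1"
    using sum_prob_conj_le[of UNIV J fV "\<lambda>\<omega>. fY2 \<omega> = y2"]
    by (simp add: divide_le_eq_1 measure_nonneg zero_less_measure_iff flip: sum_divide_distrib)
  finally show ?thesis .
qed

lemma expect_w: "expect (pUV v) (\<lambda>u. w y2 u v) \<le> 1"
proof -
  have "expect (pUV v) (\<lambda>u. w y2 u v) \<le> (\<Sum>u\<in>UNIV. pmf (pU v y2) u)"
    unfolding expect_UNIV by (intro sum_mono) (simp add: w_def)
  also have "\<dots> = 1" by (simp add: sum_pmf_eq_1)
  finally show ?thesis .
qed

text \<open>The chain from \<open>q\<close> over \<open>q1\<close> and \<open>q2\<close> to one
  integrates out \<open>x\<close>, \<open>u\<close> and \<open>v\<close> in turn. Its stages are the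
  ways in which a wrong candidate may share codewords with the truth: both \<open>u\<close> and
  \<open>v\<close>, only \<open>v\<close>, or nothing.\<close>

lemma expect_q: "expect (pX v) (\<lambda>x. q y3 v u x) \<le> q1 y3 v u"
proof (cases "pmf pV v = 0")
  case True
  thus ?thesis by (simp add: q_def pr_V density_nonneg)
next
  case False
  let ?D = "pr (\<lambda>\<omega>. fU \<omega> = u \<and> fV \<omega> = v) * pr (\<lambda>\<omega>. fY3 \<omega> = y3)"
  have "expect (pX v) (\<lambda>x. q y3 v u x)
      \<le> (\<Sum>x\<in>UNIV. pr (\<lambda>\<omega>. fX1 \<omega> = x \<and> fU \<omega> = u \<and> fY3 \<omega> = y3 \<and> fV \<omega> = v) / ?D)"
    unfolding expect_UNIV
  proof (intro sum_mono)
    fix x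
    show "pmf (pX v) x * q y3 v u x
        \<le> pr (\<lambda>\<omega>. fX1 \<omega> = x \<and> fU \<omega> = u \<and> fY3 \<omega> = y3 \<and> fV \<omega> = v) / ?D"
      using False by (cases "pmf (pX v) x = 0") (auto simp: q_def pr_XV pr_V)
  qed
  also have "\<dots> \<le> pr (\<lambda>\<omega>. fU \<omega> = u \<and> fY3 \<omega> = y3 \<and> fV \<omega> = v) / ?D"
    unfolding sum_divide_distrib[symmetric] by (intro divide_right_mono sum_prob_conj_le) auto
  finally show ?thesis by (simp add: q1_def)
qed

lemma expect_q1: "expect (pUV v) (\<lambda>u. q1 y3 v u) \<le> q2 y3 v"
proof (cases "pmf pV v = 0")
  case True
  thus ?thesis by (simp add: q1_def pr_UV density_nonneg)
next
  case False
  let ?D = "pr (\<lambda>\<omega>. fV \<omega> = v) * pr (\<lambda>\<omega>. fY3 \<omega> = y3)"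
  have "expect (pUV v) (\<lambda>u. q1 y3 v u)
      \<le> (\<Sum>u\<in>UNIV. pr (\<lambda>\<omega>. fU \<omega> = u \<and> fY3 \<omega> = y3 \<and> fV \<omega> = v) / ?D)"
    unfolding expect_UNIV
  proof (intro sum_mono)
    fix u
    show "pmf (pUV v) u * q1 y3 v u \<le> pr (\<lambda>\<omega>. fU \<omega> = u \<and> fY3 \<omega> = y3 \<and> fV \<omega> = v) / ?D"
      using False by (cases "pmf (pUV v) u = 0") (auto simp: q1_def pr_UV pr_V)
  qed
  also have "\<dots> \<le> pr (\<lambda>\<omega>. fY3 \<omega> = y3 \<and> fV \<omega> = v) / ?D"
    unfolding sum_divide_distrib[symmetric] by (intro divide_right_mono sum_prob_conj_le) auto
  finally show ?thesis by (simp add: q2_def)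
qed

lemma expect_q2: "expect pV (q2 y3) \<le> 1"
proof -
  have "expect pV (q2 y3) = (\<Sum>v\<in>UNIV. pr (\<lambda>\<omega>. fV \<omega> = v) * q2 y3 v)"
    by (simp add: expect_UNIV pr_V)
  also have "\<dots> \<le> (\<Sum>v\<in>UNIV. pr (\<lambda>\<omega>. fV \<omega> = v \<and> fY3 \<omega> = y3) / pr (\<lambda>\<omega>. fY3 \<omega> = y3))"
    by (intro sum_mono) (simp add: q2_def conj_commute)
  also have "\<dots> \<le> 1"
    using sum_prob_conj_le[of UNIV J fV "\<lambda>\<omega>. fY3 \<omega> = y3"]
    by (simp add: divide_le_eq_1 measure_nonneg zero_less_measure_iff flip: sum_divide_distrib)
  finally show ?thesis .
qed

section \<open>Change of measure from the codebook law to the joint law\<close>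

lemma pUV_pos:
  assumes "v \<in> set_pmf pV" "x \<in> set_pmf (pX v)" "y2 \<in> set_pmf (W2 x)" "u \<in> set_pmf (pU v y2)"
  shows "u \<in> set_pmf (pUV v)"
  using assms by (auto simp: pUV_def)

text \<open>The density of the target joint law when \<open>v\<close>, \<open>x\<close>,
  \<open>u\<close> follow the codebook law and outputs are counted: multiplying by p(u|v) turns
  \<open>w\<close> into p(u|v,y2).\<close>

definition step :: "'v \<Rightarrow> 'x1 \<Rightarrow> 'u \<Rightarrow> 'y2 \<Rightarrow> 'y3 \<Rightarrow> real" where
  "step v x u y2 y3 = pmf (W2 x) y2 * w y2 u v * pmf (W3 x (x2f u v y2) y2) y3"

lemma step_nonneg: "0 \<le> step v x u y2 y3"
  by (simp add: step_def density_nonneg)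

lemma change_of_measure:
  "expect pV (\<lambda>v. expect (pX v) (\<lambda>x. expect (pUV v) (\<lambda>u. \<Sum>y2\<in>UNIV. \<Sum>y3\<in>UNIV.
      step v x u y2 y3 * f v x u y2 y3)))
   = expect J (\<lambda>\<omega>. f (fV \<omega>) (fX1 \<omega>) (fU \<omega>) (fY2 \<omega>) (fY3 \<omega>))"
  unfolding expect_J
proof (intro expect_cong)
  fix v x assume v: "v \<in> set_pmf pV" and x: "x \<in> set_pmf (pX v)"
  \<comment> \<open>Cancelling \<open>pmf (pUV v) u\<close> is sound because it vanishes only where
    \<open>W2\<close> or \<open>pU\<close> already has no mass.\<close>
  have *: "pmf (pUV v) u * (pmf (W2 x) y2 * w y2 u v * c) = pmf (W2 x) y2 * (pmf (pU v y2) u * c)" for u y2 c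
    using pUV_pos[OF v x, of y2 u] by (auto simp: w_def set_pmf_iff)
  have "expect (pUV v) (\<lambda>u. \<Sum>y2\<in>UNIV. \<Sum>y3\<in>UNIV. step v x u y2 y3 * f v x u y2 y3)
      = (\<Sum>u\<in>UNIV. \<Sum>y2\<in>UNIV. \<Sum>y3\<in>UNIV. pmf (W2 x) y2 * (pmf (pU v y2) u *
          (pmf (W3 x (x2f u v y2) y2) y3 * f v x u y2 y3)))"
    unfolding expect_UNIV step_def by (simp add: sum_distrib_left mult.assoc *[unfolded mult.assoc])
  also have "\<dots> = (\<Sum>y2\<in>UNIV. \<Sum>u\<in>UNIV. \<Sum>y3\<in>UNIV. pmf (W2 x) y2 * (pmf (pU v y2) u *
          (pmf (W3 x (x2f u v y2) y2) y3 * f v x u y2 y3)))"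
    by (rule sum.swap)
  finally show "expect (pUV v) (\<lambda>u. \<Sum>y2\<in>UNIV. \<Sum>y3\<in>UNIV. step v x u y2 y3 * f v x u y2 y3)
     = expect (W2 x) (\<lambda>y2. expect (pU v y2) (\<lambda>u. expect (W3 x (x2f u v y2) y2)
         (\<lambda>y3. f (fV (v, x, y2, u, x2f u v y2, y3)) (fX1 (v, x, y2, u, x2f u v y2, y3))
           (fU (v, x, y2, u, x2f u v y2, y3)) (fY2 (v, x, y2, u, x2f u v y2, y3))
           (fY3 (v, x, y2, u, x2f u v y2, y3)))))"
    by (simp add: expect_UNIV sum_distrib_left)
qed

lemma support_J:
  assumes "v \<in> set_pmf pV" "x \<in> set_pmf (pX v)" "u \<in> set_pmf (pUV v)" "step v x u y2 y3 \<noteq> 0"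
  shows "(v, x, y2, u, x2f u v y2, y3) \<in> set_pmf J"
  using assms unfolding J_def relay_joint_def step_def w_def by (force simp: set_pmf_iff)

lemma densities_pos:
  assumes "(v, x, y2, u, x2, y3) \<in> set_pmf J"
  shows "0 < \<alpha> y2 v" "0 < w y2 u v" "0 < q y3 v u x" "0 < q1 y3 v u" "0 < q2 y3 v"
proof -
  have pos: "0 < pr Q" if "Q (v, x, y2, u, x2, y3)" for Q
    using assms that by (rule prob_pos)
  show "0 < \<alpha> y2 v" "0 < q y3 v u x" "0 < q1 y3 v u" "0 < q2 y3 v"
    unfolding \<alpha>_def q_def q1_def q2_def by (intro divide_pos_pos mult_pos_pos pos; simp)+
  have "0 < pr (\<lambda>\<omega>. fU \<omega> = u \<and> fY2 \<omega> = y2 \<and> fV \<omega> = v)" "0 < pr (\<lambda>\<omega>. fU \<omega> = u \<and> fV \<omega> = v)"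
    by (intro pos; simp)+
  thus "0 < w y2 u v" unfolding pr_UY2V pr_UV w_def by (auto simp: zero_less_mult_iff)
qed

section \<open>Mutual informations as mean log densities\<close>

lemma mi_VY2: "mi J fV fY2 = expect J (\<lambda>\<omega>. log 2 (\<alpha> (fY2 \<omega>) (fV \<omega>)))"
  unfolding mi_eq_expect \<alpha>_def ..

lemma cmi_UY2: "cmi J fU fY2 fV = expect J (\<lambda>\<omega>. log 2 (w (fY2 \<omega>) (fU \<omega>) (fV \<omega>)))"
  unfolding cmi_eq_expect
proof (intro expect_cong arg_cong[of _ _ "log 2"])
  fix \<omega> assume \<omega>: "\<omega> \<in> set_pmf J"
  have "0 < pr (\<lambda>\<omega>'. fY2 \<omega>' = fY2 \<omega> \<and> fV \<omega>' = fV \<omega>)" "0 < pr (\<lambda>\<omega>'. fV \<omega>' = fV \<omega>)"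
    by (rule prob_pos[OF \<omega>]; simp)+
  thus "pr (\<lambda>\<omega>'. fU \<omega>' = fU \<omega> \<and> fY2 \<omega>' = fY2 \<omega> \<and> fV \<omega>' = fV \<omega>) * pr (\<lambda>\<omega>'. fV \<omega>' = fV \<omega>)
     / (pr (\<lambda>\<omega>'. fU \<omega>' = fU \<omega> \<and> fV \<omega>' = fV \<omega>) * pr (\<lambda>\<omega>'. fY2 \<omega>' = fY2 \<omega> \<and> fV \<omega>' = fV \<omega>))
     = w (fY2 \<omega>) (fU \<omega>) (fV \<omega>)"
    unfolding pr_UY2V pr_UV w_def by (simp add: pr_V)
qed

lemma cmi_X1: "cmi J fX1 (\<lambda>\<omega>. (fU \<omega>, fY3 \<omega>)) fV
   = expect J (\<lambda>\<omega>. log 2 (q (fY3 \<omega>) (fV \<omega>) (fU \<omega>) (fX1 \<omega>) / q1 (fY3 \<omega>) (fV \<omega>) (fU \<omega>)))"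
  unfolding cmi_eq_expect
proof (intro expect_cong arg_cong[of _ _ "log 2"])
  fix \<omega> assume \<omega>: "\<omega> \<in> set_pmf J"
  have "0 < pr (\<lambda>\<omega>'. fU \<omega>' = fU \<omega> \<and> fV \<omega>' = fV \<omega>)" "0 < pr (\<lambda>\<omega>'. fY3 \<omega>' = fY3 \<omega>)"
    by (rule prob_pos[OF \<omega>]; simp)+
  thus "pr (\<lambda>\<omega>'. fX1 \<omega>' = fX1 \<omega> \<and> (fU \<omega>', fY3 \<omega>') = (fU \<omega>, fY3 \<omega>) \<and> fV \<omega>' = fV \<omega>) * pr (\<lambda>\<omega>'. fV \<omega>' = fV \<omega>)
     / (pr (\<lambda>\<omega>'. fX1 \<omega>' = fX1 \<omega> \<and> fV \<omega>' = fV \<omega>) * pr (\<lambda>\<omega>'. (fU \<omega>', fY3 \<omega>') = (fU \<omega>, fY3 \<omega>) \<and> fV \<omega>' = fV \<omega>))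
     = q (fY3 \<omega>) (fV \<omega>) (fU \<omega>) (fX1 \<omega>) / q1 (fY3 \<omega>) (fV \<omega>) (fU \<omega>)"
    by (simp add: q_def q1_def)
qed

lemma cmi_UY3: "cmi J fU fY3 fV
   = expect J (\<lambda>\<omega>. log 2 (q1 (fY3 \<omega>) (fV \<omega>) (fU \<omega>) / q2 (fY3 \<omega>) (fV \<omega>)))"
  unfolding cmi_eq_expect
proof (intro expect_cong arg_cong[of _ _ "log 2"])
  fix \<omega> assume \<omega>: "\<omega> \<in> set_pmf J"
  have "0 < pr (\<lambda>\<omega>'. fY3 \<omega>' = fY3 \<omega>)"
    by (rule prob_pos[OF \<omega>]) simp
  thus "pr (\<lambda>\<omega>'. fU \<omega>' = fU \<omega> \<and> fY3 \<omega>' = fY3 \<omega> \<and> fV \<omega>' = fV \<omega>) * pr (\<lambda>\<omega>'. fV \<omega>' = fV \<omega>)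
     / (pr (\<lambda>\<omega>'. fU \<omega>' = fU \<omega> \<and> fV \<omega>' = fV \<omega>) * pr (\<lambda>\<omega>'. fY3 \<omega>' = fY3 \<omega> \<and> fV \<omega>' = fV \<omega>))
     = q1 (fY3 \<omega>) (fV \<omega>) (fU \<omega>) / q2 (fY3 \<omega>) (fV \<omega>)"
    by (simp add: q1_def q2_def)
qed

lemma mi_VUY3: "mi J (\<lambda>\<omega>. (fV \<omega>, fU \<omega>)) fY3
   = expect J (\<lambda>\<omega>. log 2 (q1 (fY3 \<omega>) (fV \<omega>) (fU \<omega>)))"
  unfolding mi_eq_expect q1_def by (simp add: conj_ac)

text \<open>The ratios \<open>q / q1\<close> and \<open>q1 / q2\<close> telescope; positivity on the
  support is what allows their logarithms to be added.\<close>

lemma cmi_X1_U: "cmi J fX1 (\<lambda>\<omega>. (fU \<omega>, fY3 \<omega>)) fV + cmi J fU fY3 fV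
   = expect J (\<lambda>\<omega>. log 2 (q (fY3 \<omega>) (fV \<omega>) (fU \<omega>) (fX1 \<omega>) / q2 (fY3 \<omega>) (fV \<omega>)))"
proof -
  have pos: "0 < q (fY3 \<omega>) (fV \<omega>) (fU \<omega>) (fX1 \<omega>)" "0 < q1 (fY3 \<omega>) (fV \<omega>) (fU \<omega>)" "0 < q2 (fY3 \<omega>) (fV \<omega>)"
    if "\<omega> \<in> set_pmf J" for \<omega>
    using that densities_pos by (cases \<omega>; auto)+
  show ?thesis
    unfolding cmi_X1 cmi_UY3 expect_add[OF finite, symmetric]
    using pos by (intro expect_cong) (force simp: log_divide_pos)
qed

lemma mi_VU_X1: "mi J (\<lambda>\<omega>. (fV \<omega>, fU \<omega>)) fY3 + cmi J fX1 (\<lambda>\<omega>. (fU \<omega>, fY3 \<omega>)) fV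
   = expect J (\<lambda>\<omega>. log 2 (q (fY3 \<omega>) (fV \<omega>) (fU \<omega>) (fX1 \<omega>)))"
proof -
  have pos: "0 < q (fY3 \<omega>) (fV \<omega>) (fU \<omega>) (fX1 \<omega>)" "0 < q1 (fY3 \<omega>) (fV \<omega>) (fU \<omega>)"
    if "\<omega> \<in> set_pmf J" for \<omega>
    using that densities_pos by (cases \<omega>; auto)+
  show ?thesis
    unfolding cmi_X1 mi_VUY3 expect_add[OF finite, symmetric]
    using pos by (intro expect_cong) (force simp: log_divide_pos)
qed

text \<open>The change of measure cancels \<open>w\<close> and gives E(1 / w) \<le> 1; then ln w
  \<ge> 1 - 1 / w. The result makes the covering rate nonnegative, as rounding up with a factor 2
  requires.\<close>

lemma cmi_UY2_nonneg: "0 \<le> cmi J fU fY2 fV"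
proof -
  have pos: "0 < w (fY2 \<omega>) (fU \<omega>) (fV \<omega>)" if "\<omega> \<in> set_pmf J" for \<omega>
    using that densities_pos by (cases \<omega>) auto
  have "expect J (\<lambda>\<omega>. 1 / w (fY2 \<omega>) (fU \<omega>) (fV \<omega>))
      = expect pV (\<lambda>v. expect (pX v) (\<lambda>x. expect (pUV v) (\<lambda>u. \<Sum>y2\<in>UNIV. \<Sum>y3\<in>UNIV.
      step v x u y2 y3 * (1 / w y2 u v))))"
    by (rule change_of_measure[symmetric])
  also have "\<dots> \<le> expect pV (\<lambda>v. expect (pX v) (\<lambda>x. expect (pUV v) (\<lambda>u. \<Sum>y2\<in>UNIV. \<Sum>y3\<in>UNIV.
      pmf (W2 x) y2 * pmf (W3 x (x2f u v y2) y2) y3)))"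
    by (intro expect_mono sum_mono finite) (simp add: step_def)
  also have "\<dots> = 1" by (simp add: sum_pmf_eq_1 flip: sum_distrib_left)
  finally have "expect J (\<lambda>\<omega>. 1 / w (fY2 \<omega>) (fU \<omega>) (fV \<omega>)) \<le> 1" .
  moreover have "expect J (\<lambda>\<omega>. 1 - 1 / w (fY2 \<omega>) (fU \<omega>) (fV \<omega>))
      \<le> expect J (\<lambda>\<omega>. ln 2 * log 2 (w (fY2 \<omega>) (fU \<omega>) (fV \<omega>)))"
  proof (intro expect_mono finite)
    fix \<omega> assume "\<omega> \<in> set_pmf J"
    from pos[OF this] show "1 - 1 / w (fY2 \<omega>) (fU \<omega>) (fV \<omega>) \<le> ln 2 * log 2 (w (fY2 \<omega>) (fU \<omega>) (fV \<omega>))"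
      using ln_le_minus_one[of "1 / w (fY2 \<omega>) (fU \<omega>) (fV \<omega>)"] by (simp add: log_def ln_div)
  qed
  ultimately have "0 \<le> ln 2 * cmi J fU fY2 fV"
    by (simp add: cmi_UY2 expect_diff)
  thus ?thesis by (simp add: zero_le_mult_iff)
qed

section \<open>Block laws and concentration\<close>

definition pVn :: "nat \<Rightarrow> (nat \<Rightarrow> 'v) pmf" where
  "pVn n = Pi_pmf {..<n} undefined (\<lambda>_. pV)"

definition pXn :: "nat \<Rightarrow> (nat \<Rightarrow> 'v) \<Rightarrow> (nat \<Rightarrow> 'x1) pmf" where
  "pXn n vs = Pi_pmf {..<n} undefined (\<lambda>i. pX (vs i))"

definition pUn :: "nat \<Rightarrow> (nat \<Rightarrow> 'v) \<Rightarrow> (nat \<Rightarrow> 'u) pmf" where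
  "pUn n vs = Pi_pmf {..<n} undefined (\<lambda>i. pUV (vs i))"

lemma finite_seq: "finite (set_pmf (pVn n))" "finite (set_pmf (pXn n vs))" "finite (set_pmf (pUn n vs))"
  by (simp_all add: pVn_def pXn_def pUn_def finite_set_Pi_pmf)

text \<open>Given \<open>vs\<close>, letter i of the other codewords depends on \<open>vs i\<close>
  alone, so \<open>us\<close>, \<open>xs\<close> and \<open>vs\<close> can be integrated out letter
  by letter; the sums over output lists then factorise too.\<close>

lemma expect_memoryless:
  fixes \<phi> :: "'v \<Rightarrow> 'x1 \<Rightarrow> 'u \<Rightarrow> 'y2 \<Rightarrow> 'y3 \<Rightarrow> real"
  assumes \<phi>: "\<And>v x u y2 y3. 0 \<le> \<phi> v x u y2 y3"
  shows "(\<Sum>y2s\<in>{ys. length ys = n}. \<Sum>y3s\<in>{ys. length ys = n}.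
      expect (pVn n) (\<lambda>vs. expect (pXn n vs) (\<lambda>xs. expect (pUn n vs) (\<lambda>us.
        \<Prod>i<n. \<phi> (vs i) (xs i) (us i) (y2s ! i) (y3s ! i)))))
    = (expect pV (\<lambda>v. expect (pX v) (\<lambda>x. expect (pUV v) (\<lambda>u. \<Sum>y2\<in>UNIV. \<Sum>y3\<in>UNIV. \<phi> v x u y2 y3)))) ^ n"
proof -
  define g where "g y2 y3 = expect pV (\<lambda>v. expect (pX v) (\<lambda>x. expect (pUV v) (\<lambda>u. \<phi> v x u y2 y3)))" for y2 y3
  have "expect (pVn n) (\<lambda>vs. expect (pXn n vs) (\<lambda>xs. expect (pUn n vs) (\<lambda>us.
        \<Prod>i<n. \<phi> (vs i) (xs i) (us i) (y2s ! i) (y3s ! i))))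
      = (\<Prod>i<n. g (y2s ! i) (y3s ! i))" for y2s y3s
  proof -
    have "expect (pUn n vs) (\<lambda>us. \<Prod>i<n. \<phi> (vs i) (xs i) (us i) (y2s ! i) (y3s ! i))
        = (\<Prod>i<n. expect (pUV (vs i)) (\<lambda>u. \<phi> (vs i) (xs i) u (y2s ! i) (y3s ! i)))" for vs xs
      unfolding pUn_def by (rule expect_prod_Pi) (auto simp: \<phi>)
    moreover have "expect (pXn n vs) (\<lambda>xs. \<Prod>i<n. expect (pUV (vs i)) (\<lambda>u. \<phi> (vs i) (xs i) u (y2s ! i) (y3s ! i)))
        = (\<Prod>i<n. expect (pX (vs i)) (\<lambda>x. expect (pUV (vs i)) (\<lambda>u. \<phi> (vs i) x u (y2s ! i) (y3s ! i))))" for vs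
      unfolding pXn_def
      by (rule expect_prod_Pi[where f = "\<lambda>i x. expect (pUV (vs i)) (\<lambda>u. \<phi> (vs i) x u (y2s ! i) (y3s ! i))"])
         (auto intro!: expect_nonneg \<phi>)
    moreover have "expect (pVn n) (\<lambda>vs. \<Prod>i<n. expect (pX (vs i)) (\<lambda>x. expect (pUV (vs i)) (\<lambda>u. \<phi> (vs i) x u (y2s ! i) (y3s ! i))))
        = (\<Prod>i<n. g (y2s ! i) (y3s ! i))"
      unfolding pVn_def g_def
      by (rule expect_prod_Pi[where f = "\<lambda>i v. expect (pX v) (\<lambda>x. expect (pUV v) (\<lambda>u. \<phi> v x u (y2s ! i) (y3s ! i)))"])
         (auto intro!: expect_nonneg \<phi>)
    ultimately show ?thesis by simp
  qed
  hence "(\<Sum>y2s\<in>{ys. length ys = n}. \<Sum>y3s\<in>{ys. length ys = n}.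
      expect (pVn n) (\<lambda>vs. expect (pXn n vs) (\<lambda>xs. expect (pUn n vs) (\<lambda>us.
        \<Prod>i<n. \<phi> (vs i) (xs i) (us i) (y2s ! i) (y3s ! i)))))
      = (\<Sum>y2s\<in>{ys. length ys = n}. \<Sum>y3s\<in>{ys. length ys = n}. \<Prod>i<n. g (y2s ! i) (y3s ! i))" by simp
  also have "\<dots> = (\<Sum>y2s\<in>{ys. length ys = n}. \<Prod>i<n. \<Sum>y3\<in>UNIV. g (y2s ! i) y3)"
    by (intro sum.cong refl sum_prod_lists)
  also have "\<dots> = (\<Prod>i<n. \<Sum>y2\<in>UNIV. \<Sum>y3\<in>UNIV. g y2 y3)"
    by (rule sum_prod_lists)
  also have "(\<Sum>y2\<in>UNIV. \<Sum>y3\<in>UNIV. g y2 y3)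
      = expect pV (\<lambda>v. expect (pX v) (\<lambda>x. expect (pUV v) (\<lambda>u. \<Sum>y2\<in>UNIV. \<Sum>y3\<in>UNIV. \<phi> v x u y2 y3)))"
    unfolding g_def by (simp only: expect_sum[OF finite])
  finally show ?thesis by simp
qed

text \<open>One-sided thresholds replace closeness of empirical frequencies, as each error bound
  uses one tail only. Membership in the support makes all densities positive and costs no mass,
  since elsewhere some factor \<open>step\<close> vanishes by \<open>support_J\<close>.\<close>

definition typical :: "nat \<Rightarrow> 'k set \<Rightarrow> ('k \<Rightarrow> real) \<Rightarrow> ('k \<Rightarrow> 'v \<Rightarrow> 'x1 \<Rightarrow> 'u \<Rightarrow> 'y2 \<Rightarrow> 'y3 \<Rightarrow> real)
    \<Rightarrow> (nat \<Rightarrow> 'v) \<Rightarrow> (nat \<Rightarrow> 'x1) \<Rightarrow> (nat \<Rightarrow> 'u) \<Rightarrow> 'y2 list \<Rightarrow> 'y3 list \<Rightarrow> bool" where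
  "typical n K t f vs xs us y2s y3s \<longleftrightarrow>
    (\<forall>i<n. (vs i, xs i, y2s ! i, us i, x2f (us i) (vs i) (y2s ! i), y3s ! i) \<in> set_pmf J) \<and>
    (\<forall>k\<in>K. real n * t k < (\<Sum>i<n. f k (vs i) (xs i) (us i) (y2s ! i) (y3s ! i)))"

text \<open>A union bound: if constraint k fails, the exponential tilt of the whole block is at
  least one, so the tilted mass dominates the lost mass. By \<open>expect_memoryless\<close> the
  tilted mass is \<open>r k ^ n\<close>, with \<open>r k\<close> below one by
  \<open>chernoff_base\<close>.\<close>

lemma typical_mass:
  fixes f :: "'k \<Rightarrow> 'v \<Rightarrow> 'x1 \<Rightarrow> 'u \<Rightarrow> 'y2 \<Rightarrow> 'y3 \<Rightarrow> real"
  assumes K: "finite K"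
    and t: "\<And>k. k \<in> K \<Longrightarrow> t k < expect J (\<lambda>\<omega>. f k (fV \<omega>) (fX1 \<omega>) (fU \<omega>) (fY2 \<omega>) (fY3 \<omega>))"
  shows "\<exists>r. (\<forall>k\<in>K. 0 \<le> r k \<and> r k < 1) \<and> (\<forall>n. 1 - (\<Sum>k\<in>K. r k ^ n) \<le>
    (\<Sum>y2s\<in>{ys. length ys = n}. \<Sum>y3s\<in>{ys. length ys = n}.
      expect (pVn n) (\<lambda>vs. expect (pXn n vs) (\<lambda>xs. expect (pUn n vs) (\<lambda>us.
        if typical n K t f vs xs us y2s y3s
        then \<Prod>i<n. step (vs i) (xs i) (us i) (y2s ! i) (y3s ! i) else 0)))))"
proof -
  define F where "F k \<omega> = f k (fV \<omega>) (fX1 \<omega>) (fU \<omega>) (fY2 \<omega>) (fY3 \<omega>)"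
    for k and \<omega> :: "'v \<times> 'x1 \<times> 'y2 \<times> 'u \<times> 'x2 \<times> 'y3"
  have "\<forall>k\<in>K. \<exists>s. 0 < s \<and> expect J (\<lambda>\<omega>. exp (- s * (F k \<omega> - t k))) < 1"
    using t by (intro ballI chernoff_base) (auto simp: F_def)
  from bchoice[OF this] obtain s where s: "\<And>k. k \<in> K \<Longrightarrow> 0 < s k"
      "\<And>k. k \<in> K \<Longrightarrow> expect J (\<lambda>\<omega>. exp (- s k * (F k \<omega> - t k))) < 1"
    by blast
  define e where "e k v x u y2 y3 = exp (- s k * (f k v x u y2 y3 - t k))" for k v x u y2 y3
  define r where "r k = expect J (\<lambda>\<omega>. e k (fV \<omega>) (fX1 \<omega>) (fU \<omega>) (fY2 \<omega>) (fY3 \<omega>))" for k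
  have r: "0 \<le> r k \<and> r k < 1" if "k \<in> K" for k
    using s(2)[OF that] by (auto simp: r_def e_def F_def intro!: expect_nonneg)
  have "1 - (\<Sum>k\<in>K. r k ^ n) \<le>
    (\<Sum>y2s\<in>{ys. length ys = n}. \<Sum>y3s\<in>{ys. length ys = n}.
      expect (pVn n) (\<lambda>vs. expect (pXn n vs) (\<lambda>xs. expect (pUn n vs) (\<lambda>us.
        if typical n K t f vs xs us y2s y3s
        then \<Prod>i<n. step (vs i) (xs i) (us i) (y2s ! i) (y3s ! i) else 0))))" for n
  proof -
    let ?E = "\<lambda>F. (\<Sum>y2s\<in>{ys. length ys = n}. \<Sum>y3s\<in>{ys. length ys = n}.
      expect (pVn n) (\<lambda>vs. expect (pXn n vs) (\<lambda>xs. expect (pUn n vs) (\<lambda>us. F vs xs us y2s y3s))))"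
    define S where "S vs xs us y2s y3s = (\<Prod>i<n. step (vs i) (xs i) (us i) (y2s ! i) (y3s ! i))"
      for vs xs us y2s y3s
    define T where "T k vs xs us y2s y3s = (\<Prod>i<n. step (vs i) (xs i) (us i) (y2s ! i) (y3s ! i) *
       e k (vs i) (xs i) (us i) (y2s ! i) (y3s ! i))" for k vs xs us y2s y3s
    have one: "?E S = 1"
      unfolding S_def
      using expect_memoryless[of step, OF step_nonneg] change_of_measure[of "\<lambda>_ _ _ _ _. 1"] by simp
    have rk: "?E (T k) = r k ^ n" for k
      unfolding T_def r_def
      using expect_memoryless[of "\<lambda>v x u y2 y3. step v x u y2 y3 * e k v x u y2 y3"]
        change_of_measure[of "e k"] by (simp add: step_nonneg e_def)
    have "1 - (\<Sum>k\<in>K. r k ^ n) = ?E S - (\<Sum>k\<in>K. ?E (T k))" by (simp add: one rk)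
    also have "\<dots> = ?E (\<lambda>vs xs us y2s y3s. S vs xs us y2s y3s - (\<Sum>k\<in>K. T k vs xs us y2s y3s))"
    proof -
      have "(\<Sum>k\<in>K. ?E (T k)) = ?E (\<lambda>vs xs us y2s y3s. \<Sum>k\<in>K. T k vs xs us y2s y3s)"
        by (simp only: expect_sum[OF finite_seq(1)] expect_sum[OF finite_seq(2)] expect_sum[OF finite_seq(3)])
           (rule sum_swap3[symmetric])
      thus ?thesis
        by (simp only: expect_diff[OF finite_seq(1)] expect_diff[OF finite_seq(2)] expect_diff[OF finite_seq(3)]
            sum_subtractf)
    qed
    also have "\<dots> \<le> ?E (\<lambda>vs xs us y2s y3s. if typical n K t f vs xs us y2s y3s then S vs xs us y2s y3s else 0)"
    proof (intro sum_mono expect_mono finite_seq)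
      fix vs xs us and y2s :: "'y2 list" and y3s :: "'y3 list"
      assume supp: "vs \<in> set_pmf (pVn n)" "xs \<in> set_pmf (pXn n vs)" "us \<in> set_pmf (pUn n vs)"
      have S_nonneg: "0 \<le> S vs xs us y2s y3s" unfolding S_def by (intro prod_nonneg) (auto simp: step_nonneg)
      have T_nonneg: "0 \<le> T k vs xs us y2s y3s" for k
        unfolding T_def e_def by (intro prod_nonneg) (auto simp: step_nonneg)
      show "S vs xs us y2s y3s - (\<Sum>k\<in>K. T k vs xs us y2s y3s)
        \<le> (if typical n K t f vs xs us y2s y3s then S vs xs us y2s y3s else 0)"
      proof (cases "typical n K t f vs xs us y2s y3s \<or> S vs xs us y2s y3s = 0")
        case True
        thus ?thesis using T_nonneg by (auto intro!: sum_nonneg)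
      next
        case False
        have "(vs i, xs i, y2s ! i, us i, x2f (us i) (vs i) (y2s ! i), y3s ! i) \<in> set_pmf J" if "i < n" for i
          using False supp that
          by (intro support_J) (auto simp: S_def pVn_def pXn_def pUn_def set_Pi_pmf PiE_dflt_def)
        with False obtain k where k: "k \<in> K"
            "(\<Sum>i<n. f k (vs i) (xs i) (us i) (y2s ! i) (y3s ! i)) \<le> real n * t k"
          unfolding typical_def by (auto simp: not_less)
        have "T k vs xs us y2s y3s = S vs xs us y2s y3s *
            exp (- s k * ((\<Sum>i<n. f k (vs i) (xs i) (us i) (y2s ! i) (y3s ! i)) - real n * t k))"
          by (simp add: T_def S_def prod.distrib e_def flip: exp_sum)
             (simp add: sum_negf sum_subtractf flip: sum_distrib_left)
        moreover have "1 \<le> exp (- s k * ((\<Sum>i<n. f k (vs i) (xs i) (us i) (y2s ! i) (y3s ! i)) - real n * t k))"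
          using s(1)[OF k(1)] k(2) by (simp add: mult_le_0_iff)
        ultimately have "S vs xs us y2s y3s * 1 \<le> T k vs xs us y2s y3s"
          using S_nonneg by (simp only: mult_left_mono)
        also have "\<dots> \<le> (\<Sum>k\<in>K. T k vs xs us y2s y3s)"
          using k K T_nonneg by (intro member_le_sum) auto
        finally show ?thesis using False by simp
      qed
    qed
    finally show ?thesis unfolding S_def .
  qed
  with r show ?thesis by blast
qed

text \<open>
  These are I(V;Y2), I(U;Y2|V), I(X1;U,Y3|V), I(X1;U,Y3|V) + I(U;Y3|V) and
  I(V,U;Y3) + I(X1;U,Y3|V).
\<close>

abbreviation "IV \<equiv> expect J (\<lambda>\<omega>. log 2 (\<alpha> (fY2 \<omega>) (fV \<omega>)))"
abbreviation "IK \<equiv> expect J (\<lambda>\<omega>. log 2 (w (fY2 \<omega>) (fU \<omega>) (fV \<omega>)))"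
abbreviation "IA \<equiv> expect J (\<lambda>\<omega>. log 2 (q (fY3 \<omega>) (fV \<omega>) (fU \<omega>) (fX1 \<omega>) / q1 (fY3 \<omega>) (fV \<omega>) (fU \<omega>)))"
abbreviation "IAD \<equiv> expect J (\<lambda>\<omega>. log 2 (q (fY3 \<omega>) (fV \<omega>) (fU \<omega>) (fX1 \<omega>) / q2 (fY3 \<omega>) (fV \<omega>)))"
abbreviation "IQ \<equiv> expect J (\<lambda>\<omega>. log 2 (q (fY3 \<omega>) (fV \<omega>) (fU \<omega>) (fX1 \<omega>)))"

text \<open>The entries follow the order of the five numerical conditions of
  \<open>one_shot_code\<close>. Entry 1 is inverted because covering needs \<open>w\<close> bounded
  above, while \<open>typical\<close> supplies lower bounds on sums.\<close>

definition log_density :: "nat \<Rightarrow> 'v \<Rightarrow> 'x1 \<Rightarrow> 'u \<Rightarrow> 'y2 \<Rightarrow> 'y3 \<Rightarrow> real" where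
  "log_density k v x u y2 y3 = [log 2 (\<alpha> y2 v), log 2 (1 / w y2 u v), log 2 (q y3 v u x / q1 y3 v u),
     log 2 (q y3 v u x / q2 y3 v), log 2 (q y3 v u x)] ! k"

definition threshold :: "real \<Rightarrow> nat \<Rightarrow> real" where
  "threshold \<delta> k = [IV, - IK, IA, IAD, IQ] ! k - \<delta>"

abbreviation good :: "real \<Rightarrow> nat \<Rightarrow> (nat \<Rightarrow> 'v) \<Rightarrow> (nat \<Rightarrow> 'x1) \<Rightarrow> (nat \<Rightarrow> 'u) \<Rightarrow> 'y2 list \<Rightarrow> 'y3 list \<Rightarrow> bool" where
  "good \<delta> n \<equiv> typical n {0, 1, 2, 3, 4} (threshold \<delta>) log_density"

lemma threshold_less:
  assumes "0 < \<delta>" "k \<in> {0, 1, 2, 3, 4}"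
  shows "threshold \<delta> k < expect J (\<lambda>\<omega>. log_density k (fV \<omega>) (fX1 \<omega>) (fU \<omega>) (fY2 \<omega>) (fY3 \<omega>))"
proof -
  have "expect J (\<lambda>\<omega>. log 2 (1 / w (fY2 \<omega>) (fU \<omega>) (fV \<omega>))) = expect J (\<lambda>\<omega>. - log 2 (w (fY2 \<omega>) (fU \<omega>) (fV \<omega>)))"
  proof (intro expect_cong)
    fix \<omega> assume "\<omega> \<in> set_pmf J"
    hence "0 < w (fY2 \<omega>) (fU \<omega>) (fV \<omega>)" using densities_pos by (cases \<omega>) auto
    thus "log 2 (1 / w (fY2 \<omega>) (fU \<omega>) (fV \<omega>)) = - log 2 (w (fY2 \<omega>) (fU \<omega>) (fV \<omega>))"
      by (simp add: log_divide_pos)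
  qed
  thus ?thesis using assms by (auto simp: threshold_def log_density_def)
qed

lemma goodD:
  assumes "good \<delta> n vs xs us y2s y3s"
  shows "2 powr (real n * (IV - \<delta>)) \<le> (\<Prod>i<n. \<alpha> (y2s ! i) (vs i))"
    and "(\<Prod>i<n. w (y2s ! i) (us i) (vs i)) \<le> 2 powr (real n * (IK + \<delta>))"
    and "2 powr (real n * (IA - \<delta>)) * (\<Prod>i<n. q1 (y3s ! i) (vs i) (us i)) \<le> (\<Prod>i<n. q (y3s ! i) (vs i) (us i) (xs i))"
    and "2 powr (real n * (IAD - \<delta>)) * (\<Prod>i<n. q2 (y3s ! i) (vs i)) \<le> (\<Prod>i<n. q (y3s ! i) (vs i) (us i) (xs i))"
    and "2 powr (real n * (IQ - \<delta>)) \<le> (\<Prod>i<n. q (y3s ! i) (vs i) (us i) (xs i))"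
    and "0 < (\<Prod>i<n. \<alpha> (y2s ! i) (vs i))" "0 < (\<Prod>i<n. w (y2s ! i) (us i) (vs i))"
      "0 < (\<Prod>i<n. q (y3s ! i) (vs i) (us i) (xs i))"
proof -
  have pos: "0 < \<alpha> (y2s ! i) (vs i)" "0 < w (y2s ! i) (us i) (vs i)" "0 < q (y3s ! i) (vs i) (us i) (xs i)"
      "0 < q1 (y3s ! i) (vs i) (us i)" "0 < q2 (y3s ! i) (vs i)" if "i < n" for i
    using assms that densities_pos[of "vs i" "xs i" "y2s ! i" "us i" "x2f (us i) (vs i) (y2s ! i)" "y3s ! i"]
    by (auto simp: typical_def)
  have sums: "real n * threshold \<delta> k < (\<Sum>i<n. log_density k (vs i) (xs i) (us i) (y2s ! i) (y3s ! i))"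
    if "k \<in> {0, 1, 2, 3, 4}" for k
    using assms that unfolding typical_def by blast
  show "2 powr (real n * (IV - \<delta>)) \<le> (\<Prod>i<n. \<alpha> (y2s ! i) (vs i))"
    using sums[of 0] pos by (intro powr_le_prod) (auto simp: threshold_def log_density_def)
  show "2 powr (real n * (IQ - \<delta>)) \<le> (\<Prod>i<n. q (y3s ! i) (vs i) (us i) (xs i))"
    using sums[of 4] pos by (intro powr_le_prod) (auto simp: threshold_def log_density_def)
  show wp: "0 < (\<Prod>i<n. w (y2s ! i) (us i) (vs i))"
    and "0 < (\<Prod>i<n. \<alpha> (y2s ! i) (vs i))" "0 < (\<Prod>i<n. q (y3s ! i) (vs i) (us i) (xs i))"
    using pos by (auto intro!: prod_pos)
  have q1p: "0 < (\<Prod>i<n. q1 (y3s ! i) (vs i) (us i))" and q2p: "0 < (\<Prod>i<n. q2 (y3s ! i) (vs i))"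
    using pos by (auto intro!: prod_pos)
  have flip_bound: "W \<le> 2 powr z" if "0 < W" "2 powr (- z) \<le> 1 / W" for W z :: real
    using that by (simp add: powr_minus field_simps)
  have "2 powr (- (real n * (IK + \<delta>))) \<le> (\<Prod>i<n. 1 / w (y2s ! i) (us i) (vs i))"
    using sums[of 1] pos by (intro powr_le_prod) (auto simp: threshold_def log_density_def algebra_simps)
  also have "\<dots> = 1 / (\<Prod>i<n. w (y2s ! i) (us i) (vs i))" by (simp add: prod_dividef)
  finally show "(\<Prod>i<n. w (y2s ! i) (us i) (vs i)) \<le> 2 powr (real n * (IK + \<delta>))"
    by (rule flip_bound[OF wp])
  have "2 powr (real n * (IA - \<delta>)) \<le> (\<Prod>i<n. q (y3s ! i) (vs i) (us i) (xs i) / q1 (y3s ! i) (vs i) (us i))"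
    using sums[of 2] pos by (intro powr_le_prod) (auto simp: threshold_def log_density_def)
  thus "2 powr (real n * (IA - \<delta>)) * (\<Prod>i<n. q1 (y3s ! i) (vs i) (us i)) \<le> (\<Prod>i<n. q (y3s ! i) (vs i) (us i) (xs i))"
    using q1p by (simp add: prod_dividef pos_le_divide_eq)
  have "2 powr (real n * (IAD - \<delta>)) \<le> (\<Prod>i<n. q (y3s ! i) (vs i) (us i) (xs i) / q2 (y3s ! i) (vs i))"
    using sums[of 3] pos by (intro powr_le_prod) (auto simp: threshold_def log_density_def)
  thus "2 powr (real n * (IAD - \<delta>)) * (\<Prod>i<n. q2 (y3s ! i) (vs i)) \<le> (\<Prod>i<n. q (y3s ! i) (vs i) (us i) (xs i))"
    using q2p by (simp add: prod_dividef pos_le_divide_eq)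
qed

text \<open>By the change of measure this is the probability of \<open>good\<close> under n
  independent copies of \<open>J\<close>, written in the form in which the one-shot bound produces
  it.\<close>

definition good_mass :: "real \<Rightarrow> nat \<Rightarrow> real" where
  "good_mass \<delta> n = (\<Sum>y2s\<in>{ys. length ys = n}. \<Sum>y3s\<in>{ys. length ys = n}.
      expect (pVn n) (\<lambda>vs. expect (pXn n vs) (\<lambda>xs. expect (pUn n vs) (\<lambda>us.
        if good \<delta> n vs xs us y2s y3s
        then \<Prod>i<n. step (vs i) (xs i) (us i) (y2s ! i) (y3s ! i) else 0))))"

section \<open>From the one-shot bound to codes for the channel\<close>

lemma block_code:
  assumes M: "1 \<le> M" "M \<le> M1 * M2" and L: "1 \<le> L" and \<epsilon>: "0 \<le> \<epsilon>"
    and c1: "real (M1 - 1) \<le> \<epsilon> * 2 powr (real n * (IV - \<delta>))"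
    and c2: "2 powr (real n * (IK + \<delta>)) \<le> \<epsilon> * real L"
    and c3: "real (M2 - 1) \<le> \<epsilon> * 2 powr (real n * (IA - \<delta>))"
    and c4: "real (M2 - 1) * real L \<le> \<epsilon> * 2 powr (real n * (IAD - \<delta>))"
    and c5: "real (M1 - 1) * (real M2 * real L) \<le> \<epsilon> * 2 powr (real n * (IQ - \<delta>))"
  shows "\<exists>enc rel dec. nc_valid_code n M enc rel \<and>
     nc_error_prob W2 W3 n M enc rel dec \<le> 1 - (1 - 5 * \<epsilon>) * good_mass \<delta> n"
proof -
  interpret S: superposition_coding "pVn n" "pXn n" "pUn n" M1 M2 L
    by standard (rule finite_seq)+
  define P2 where "P2 xs y2s = (\<Prod>i<n. pmf (W2 (xs i)) (y2s ! i))" for xs y2s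
  define P3 where "P3 xs us vs y2s y3s =
      (\<Prod>i<n. pmf (W3 (xs i) (x2f (us i) (vs i) (y2s ! i)) (y2s ! i)) (y3s ! i))" for xs us vs y2s y3s
  define \<alpha>n where "\<alpha>n y2s vs = (\<Prod>i<n. \<alpha> (y2s ! i) (vs i))" for y2s vs
  define wn where "wn y2s us vs = (\<Prod>i<n. w (y2s ! i) (us i) (vs i))" for y2s us vs
  define qn where "qn y3s vs us xs = (\<Prod>i<n. q (y3s ! i) (vs i) (us i) (xs i))" for y3s vs us xs
  define q1n where "q1n y3s vs us = (\<Prod>i<n. q1 (y3s ! i) (vs i) (us i))" for y3s vs us
  define q2n where "q2n y3s vs = (\<Prod>i<n. q2 (y3s ! i) (vs i))" for y3s vs
  have nonneg: "0 \<le> P2 xs y2s" "0 \<le> P3 xs us vs y2s y3s" "0 \<le> \<alpha>n y2s vs" "0 \<le> wn y2s us vs"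
      "0 \<le> qn y3s vs us xs" "0 \<le> q1n y3s vs us" "0 \<le> q2n y3s vs" for xs us vs y2s y3s
    unfolding P2_def P3_def \<alpha>n_def wn_def qn_def q1n_def q2n_def
    by (intro prod_nonneg; auto intro: density_nonneg)+
  have "\<exists>enc relay dec.
    (1 - 5 * \<epsilon>) * (\<Sum>y2s\<in>{ys. length ys = n}. \<Sum>y3s\<in>{ys. length ys = n}.
      expect (pVn n) (\<lambda>vs. expect (pXn n vs) (\<lambda>xs. expect (pUn n vs) (\<lambda>us.
        if good \<delta> n vs xs us y2s y3s then P2 xs y2s * wn y2s us vs * P3 xs us vs y2s y3s else 0))))
    \<le> (1 / real M) * (\<Sum>m\<in>{1..M}. \<Sum>y2s\<in>{ys. length ys = n}. \<Sum>y3s\<in>{ys. length ys = n}.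
        P2 (enc m) y2s * P3 (enc m) (fst (relay y2s)) (snd (relay y2s)) y2s y3s *
        (if dec y3s = Some m then 1 else 0))"
  proof (rule S.one_shot_code[where \<alpha> = \<alpha>n and q = qn and ?q1.0 = q1n and ?q2.0 = q2n])
    show "finite {ys :: 'y2 list. length ys = n}" "finite {ys :: 'y3 list. length ys = n}"
      using finite_lists_length_eq[of "UNIV :: 'y2 set"] finite_lists_length_eq[of "UNIV :: 'y3 set"] by auto
    show "expect (pVn n) (\<alpha>n y2s) \<le> 1" for y2s
      unfolding pVn_def \<alpha>n_def
      by (subst expect_prod_Pi) (auto intro!: prod_le_1 expect_nonneg expect_\<alpha> density_nonneg)
    show "expect (pUn n vs) (\<lambda>us. wn y2s us vs) \<le> 1" for y2s vs
      unfolding pUn_def wn_def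
      by (subst expect_prod_Pi) (auto intro!: prod_le_1 expect_nonneg expect_w density_nonneg)
    show "expect (pXn n vs) (\<lambda>xs. qn y3s vs us xs) \<le> q1n y3s vs us" for y3s vs us
      unfolding pXn_def qn_def q1n_def
      by (subst expect_prod_Pi) (auto intro!: prod_mono expect_nonneg expect_q density_nonneg)
    show "expect (pUn n vs) (\<lambda>us. q1n y3s vs us) \<le> q2n y3s vs" for y3s vs
      unfolding pUn_def q1n_def q2n_def
      by (subst expect_prod_Pi) (auto intro!: prod_mono expect_nonneg expect_q1 density_nonneg)
    show "expect (pVn n) (q2n y3s) \<le> 1" for y3s
      unfolding pVn_def q2n_def
      by (subst expect_prod_Pi) (auto intro!: prod_le_1 expect_nonneg expect_q2 density_nonneg)
  next
    fix vs xs us and y2s :: "'y2 list" and y3s :: "'y3 list"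
    assume "good \<delta> n vs xs us y2s y3s"
    note g = goodD[OF this, folded \<alpha>n_def wn_def qn_def q1n_def q2n_def]
    have "real (M1 - 1) \<le> \<epsilon> * \<alpha>n y2s vs"
      using c1 mult_left_mono[OF g(1) \<epsilon>] by linarith
    moreover have "wn y2s us vs \<le> \<epsilon> * real L" using c2 g(2) by linarith
    moreover have "real (M2 - 1) * q1n y3s vs us \<le> \<epsilon> * qn y3s vs us xs"
      using mult_right_mono[OF c3 nonneg(6)[of y3s vs us]] mult_left_mono[OF g(3) \<epsilon>]
      by (simp only: mult.assoc)
    moreover have "real (M2 - 1) * real L * q2n y3s vs \<le> \<epsilon> * qn y3s vs us xs"
      using mult_right_mono[OF c4 nonneg(7)[of y3s vs]] mult_left_mono[OF g(4) \<epsilon>]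
      by (simp only: mult.assoc)
    moreover have "real (M1 - 1) * (real M2 * real L) \<le> \<epsilon> * qn y3s vs us xs"
      using c5 mult_left_mono[OF g(5) \<epsilon>] by linarith
    ultimately show "0 < \<alpha>n y2s vs \<and> 0 < wn y2s us vs \<and> 0 < qn y3s vs us xs \<and>
        real (M1 - 1) \<le> \<epsilon> * \<alpha>n y2s vs \<and> wn y2s us vs \<le> \<epsilon> * real L \<and>
        real (M2 - 1) * q1n y3s vs us \<le> \<epsilon> * qn y3s vs us xs \<and>
        real (M2 - 1) * real L * q2n y3s vs \<le> \<epsilon> * qn y3s vs us xs \<and>
        real (M1 - 1) * (real M2 * real L) \<le> \<epsilon> * qn y3s vs us xs"
      using g(6-8) by blast
  qed (use M L nonneg in auto)
  then obtain X relay dec where *: "(1 - 5 * \<epsilon>) * (\<Sum>y2s\<in>{ys. length ys = n}. \<Sum>y3s\<in>{ys. length ys = n}.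
      expect (pVn n) (\<lambda>vs. expect (pXn n vs) (\<lambda>xs. expect (pUn n vs) (\<lambda>us.
        if good \<delta> n vs xs us y2s y3s then P2 xs y2s * wn y2s us vs * P3 xs us vs y2s y3s else 0))))
    \<le> (1 / real M) * (\<Sum>m\<in>{1..M}. \<Sum>y2s\<in>{ys. length ys = n}. \<Sum>y3s\<in>{ys. length ys = n}.
        P2 (X m) y2s * P3 (X m) (fst (relay y2s)) (snd (relay y2s)) y2s y3s *
        (if dec y3s = Some m then 1 else 0))" by blast
  define enc where "enc m = map (X m) [0..<n]" for m
  \<comment> \<open>Noncausality is used here: \<open>relay y2s\<close> picks the pair of sequences
    from the full received block, and only \<open>x2f\<close> acts letter by letter.\<close>
  define rel where "rel y2s = map (\<lambda>i. x2f (fst (relay y2s) i) (snd (relay y2s) i) (y2s ! i)) [0..<n]" for y2s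
  have st: "P2 xs y2s * wn y2s us vs * P3 xs us vs y2s y3s = (\<Prod>i<n. step (vs i) (xs i) (us i) (y2s ! i) (y3s ! i))"
    for xs us vs y2s y3s
    by (simp add: P2_def wn_def P3_def step_def prod.distrib)
  have pp: "P2 (X m) y2s * P3 (X m) (fst (relay y2s)) (snd (relay y2s)) y2s y3s =
    (\<Prod>i<n. pmf (W2 (enc m ! i)) (y2s ! i) * pmf (W3 (enc m ! i) (rel y2s ! i) (y2s ! i)) (y3s ! i))" for m y2s y3s
    by (simp add: P2_def P3_def enc_def rel_def flip: prod.distrib)
  have "nc_error_prob W2 W3 n M enc rel dec \<le> 1 - (1 - 5 * \<epsilon>) * good_mass \<delta> n"
    using *[unfolded st pp] unfolding nc_error_prob_eq[OF M(1)] good_mass_def by linarith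
  moreover have "nc_valid_code n M enc rel" by (simp add: nc_valid_code_def enc_def rel_def)
  ultimately show ?thesis by blast
qed

section \<open>Achievable rates and capacity\<close>

lemma achievable:
  assumes R: "0 \<le> R" "R < IQ - IK" "R < IV + IA" "R < IV + IAD - IK"
  shows "nc_achievable W2 W3 R"
proof -
  obtain \<delta> R1 R2 where \<delta>: "0 < \<delta>" and R12: "0 \<le> R1" "0 \<le> R2" "R1 + R2 = R"
    and r1: "R1 = 0 \<or> R1 \<le> IV - 2 * \<delta>"
    and r2: "R2 = 0 \<or> R2 \<le> IA - 2 * \<delta> \<and> R2 + IK + 2 * \<delta> \<le> IAD - 2 * \<delta>"
    and r3: "R + IK + 2 * \<delta> \<le> IQ - 2 * \<delta>"
    by (rule rate_split[OF R])
  \<comment> \<open>One \<delta> above \<open>IK\<close> pays for the slack in the threshold on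
    \<open>w\<close>, the other makes the covering term decay like \<open>e n\<close>. The packing
    conditions spend their gaps of 2 * \<delta> in the same way.\<close>
  define RL where "RL = IK + 2 * \<delta>"
  have RL: "0 \<le> RL" using cmi_UY2_nonneg \<delta> by (simp add: RL_def cmi_UY2)
  define e where "e n = 2 powr (- (real n * \<delta>))" for n
  \<comment> \<open>The 4 absorbs the two factors 2 from rounding up \<open>M2\<close> and
    \<open>L\<close> in the last condition.\<close>
  define \<epsilon> where "\<epsilon> n = 4 * e n" for n
  have e: "0 < e n" for n by (simp add: e_def)
  have e_mult: "e n * 2 powr (real n * (x - \<delta>)) = 2 powr (real n * (x - 2 * \<delta>))" for n x
    by (simp add: e_def algebra_simps flip: powr_add)
  have mono: "2 powr (real n * x) \<le> 2 powr (real n * y)" if "x \<le> y" for n x y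
    using that by (simp add: mult_left_mono)
  have "\<exists>enc rel dec. nc_valid_code n (num_msgs n R) enc rel \<and>
     nc_error_prob W2 W3 n (num_msgs n R) enc rel dec \<le> 1 - (1 - 5 * \<epsilon> n) * good_mass \<delta> n" for n
  proof -
    define M1 M2 L where "M1 = num_msgs n R1" and "M2 = num_msgs n R2" and "L = num_msgs n RL"
    have M1: "real (M1 - 1) \<le> 2 powr (real n * R1)" unfolding M1_def by (rule num_msgs_bounds)
    have M2: "real (M2 - 1) \<le> 2 powr (real n * R2)" "real M2 \<le> 2 * 2 powr (real n * R2)"
      unfolding M2_def by (rule num_msgs_bounds(2), rule num_msgs_bounds(3)[OF R12(2)])
    have L: "2 powr (real n * RL) \<le> real L" "real L \<le> 2 * 2 powr (real n * RL)"
      unfolding L_def by (rule num_msgs_bounds(1), rule num_msgs_bounds(3)[OF RL])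
    show ?thesis
    proof (rule block_code[of _ M1 M2 L])
      show "1 \<le> num_msgs n R" "1 \<le> L" unfolding L_def by (rule num_msgs_bounds)+
      show "num_msgs n R \<le> M1 * M2" unfolding M1_def M2_def using num_msgs_add_le R12(3) by blast
      show "0 \<le> \<epsilon> n" using e[of n] by (simp add: \<epsilon>_def)
      have le\<epsilon>: "z \<le> \<epsilon> n * 2 powr (real n * (x - \<delta>))" if "z \<le> 4 * 2 powr (real n * (x - 2 * \<delta>))" for z x
        using that unfolding \<epsilon>_def mult.assoc e_mult .
      show "real (M1 - 1) \<le> \<epsilon> n * 2 powr (real n * (IV - \<delta>))"
      proof (rule le\<epsilon>)
        show "real (M1 - 1) \<le> 4 * 2 powr (real n * (IV - 2 * \<delta>))"
          using r1
        proof
          assume "R1 = 0"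
          hence "M1 = 1" by (simp add: M1_def num_msgs_bounds(5))
          thus ?thesis by simp
        next
          assume "R1 \<le> IV - 2 * \<delta>"
          from M1 mono[OF this, of n] show ?thesis by linarith
        qed
      qed
      have "e n * (2 * 2 powr (real n * RL)) = 2 * 2 powr (real n * (IK + \<delta>))"
        by (simp add: e_def RL_def algebra_simps flip: powr_add)
      hence "2 powr (real n * (IK + \<delta>)) \<le> e n * (2 powr (real n * RL))" by simp
      also have "\<dots> \<le> \<epsilon> n * real L"
        unfolding \<epsilon>_def using e[of n] L(1) by (intro mult_mono) auto
      finally show "2 powr (real n * (IK + \<delta>)) \<le> \<epsilon> n * real L" .
      show "real (M2 - 1) \<le> \<epsilon> n * 2 powr (real n * (IA - \<delta>))"
      proof (rule le\<epsilon>)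
        show "real (M2 - 1) \<le> 4 * 2 powr (real n * (IA - 2 * \<delta>))"
          using r2
        proof
          assume "R2 = 0"
          hence "M2 = 1" by (simp add: M2_def num_msgs_bounds(5))
          thus ?thesis by simp
        next
          assume "R2 \<le> IA - 2 * \<delta> \<and> R2 + IK + 2 * \<delta> \<le> IAD - 2 * \<delta>"
          with M2(1) mono[of R2 "IA - 2 * \<delta>" n] show ?thesis by linarith
        qed
      qed
      show "real (M2 - 1) * real L \<le> \<epsilon> n * 2 powr (real n * (IAD - \<delta>))"
      proof (rule le\<epsilon>)
        show "real (M2 - 1) * real L \<le> 4 * 2 powr (real n * (IAD - 2 * \<delta>))"
          using r2
        proof
          assume "R2 = 0"
          hence "M2 = 1" by (simp add: M2_def num_msgs_bounds(5))
          thus ?thesis by simp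
        next
          assume r: "R2 \<le> IA - 2 * \<delta> \<and> R2 + IK + 2 * \<delta> \<le> IAD - 2 * \<delta>"
          have "real (M2 - 1) * real L \<le> 2 powr (real n * R2) * (2 * 2 powr (real n * RL))"
            by (intro mult_mono M2 L) auto
          also have "\<dots> = 2 * 2 powr (real n * (R2 + RL))" by (simp add: distrib_left powr_add)
          also have "\<dots> \<le> 2 * 2 powr (real n * (IAD - 2 * \<delta>))"
            using r by (intro mult_left_mono mono) (auto simp: RL_def)
          finally show ?thesis by (rule order_trans) simp
        qed
      qed
      show "real (M1 - 1) * (real M2 * real L) \<le> \<epsilon> n * 2 powr (real n * (IQ - \<delta>))"
      proof (rule le\<epsilon>)
        have "real (M1 - 1) * (real M2 * real L)
            \<le> 2 powr (real n * R1) * ((2 * 2 powr (real n * R2)) * (2 * 2 powr (real n * RL)))"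
          by (intro mult_mono M1 M2 L) auto
        also have "\<dots> = 4 * 2 powr (real n * (R + RL))"
          by (simp add: distrib_left powr_add flip: R12(3))
        also have "\<dots> \<le> 4 * 2 powr (real n * (IQ - 2 * \<delta>))"
          using r3 by (intro mult_left_mono mono) (auto simp: RL_def)
        finally show "real (M1 - 1) * (real M2 * real L) \<le> 4 * 2 powr (real n * (IQ - 2 * \<delta>))" .
      qed
    qed
  qed
  hence "\<forall>n. \<exists>c. nc_valid_code n (num_msgs n R) (fst c) (fst (snd c)) \<and>
     nc_error_prob W2 W3 n (num_msgs n R) (fst c) (fst (snd c)) (snd (snd c)) \<le> 1 - (1 - 5 * \<epsilon> n) * good_mass \<delta> n"
    by simp
  from choice[OF this] obtain c where c: "\<And>n. nc_valid_code n (num_msgs n R) (fst (c n)) (fst (snd (c n)))"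
    "\<And>n. nc_error_prob W2 W3 n (num_msgs n R) (fst (c n)) (fst (snd (c n))) (snd (snd (c n)))
       \<le> 1 - (1 - 5 * \<epsilon> n) * good_mass \<delta> n" by blast
  define enc rel dec where "enc n = fst (c n)" and "rel n = fst (snd (c n))" and "dec n = snd (snd (c n))" for n
  note code = c[folded enc_def rel_def dec_def]
  have "\<exists>r. (\<forall>k\<in>{0, 1, 2, 3, 4::nat}. 0 \<le> r k \<and> r k < 1) \<and>
      (\<forall>n. 1 - (\<Sum>k\<in>{0, 1, 2, 3, 4}. r k ^ n) \<le> good_mass \<delta> n)"
    unfolding good_mass_def by (rule typical_mass[OF _ threshold_less[OF \<delta>]]) simp_all
  then obtain r where r: "\<forall>k\<in>{0, 1, 2, 3, 4::nat}. 0 \<le> r k \<and> r k < 1"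
    "\<forall>n. 1 - (\<Sum>k\<in>{0, 1, 2, 3, 4}. r k ^ n) \<le> good_mass \<delta> n"
    by (elim exE conjE) (rule that)
  have "(\<lambda>n. (2 powr (- \<delta>)) ^ n) \<longlonglongrightarrow> 0"
    using \<delta> powr_less_mono[of "- \<delta>" 0 2] by (intro LIMSEQ_realpow_zero) auto
  moreover have "(2 powr (- \<delta>)) ^ n = e n" for n
    by (simp add: e_def powr_powr mult.commute flip: powr_realpow)
  ultimately have e0: "e \<longlonglongrightarrow> 0" by simp
  have \<epsilon>0: "\<epsilon> \<longlonglongrightarrow> 0" unfolding \<epsilon>_def by (rule tendsto_mult_right_zero[OF e0])
  have r0: "(\<lambda>n. \<Sum>k\<in>{0, 1, 2, 3, 4}. r k ^ n) \<longlonglongrightarrow> (\<Sum>k\<in>{0, 1, 2, 3, 4::nat}. 0)"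
    using r(1) by (intro tendsto_sum LIMSEQ_realpow_zero) auto
  have "(\<lambda>n. 1 - (1 - 5 * \<epsilon> n) * (1 - (\<Sum>k\<in>{0, 1, 2, 3, 4}. r k ^ n)))
      \<longlonglongrightarrow> 1 - (1 - 5 * 0) * (1 - (\<Sum>k\<in>{0, 1, 2, 3, 4::nat}. 0))"
    by (intro tendsto_diff tendsto_mult tendsto_const \<epsilon>0 r0)
  hence lim: "(\<lambda>n. 1 - (1 - 5 * \<epsilon> n) * (1 - (\<Sum>k\<in>{0, 1, 2, 3, 4}. r k ^ n))) \<longlonglongrightarrow> 0" by simp
  have "\<forall>\<^sub>F n in sequentially. \<epsilon> n < 1 / 5"
    using \<epsilon>0 by (rule order_tendstoD) simp
  hence "\<forall>\<^sub>F n in sequentially. nc_error_prob W2 W3 n (num_msgs n R) (enc n) (rel n) (dec n)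
      \<le> 1 - (1 - 5 * \<epsilon> n) * (1 - (\<Sum>k\<in>{0, 1, 2, 3, 4}. r k ^ n))"
  proof eventually_elim
    case (elim n)
    \<comment> \<open>Inserting a lower bound for \<open>good_mass\<close> requires 1 - 5 *
      \<epsilon> n to be nonnegative, which is guaranteed only eventually.\<close>
    hence "(1 - 5 * \<epsilon> n) * (1 - (\<Sum>k\<in>{0, 1, 2, 3, 4}. r k ^ n)) \<le> (1 - 5 * \<epsilon> n) * good_mass \<delta> n"
      by (intro mult_left_mono r(2)[rule_format]) simp
    with code(2)[of n] show ?case by linarith
  qed
  moreover have "0 \<le> nc_error_prob W2 W3 n (num_msgs n R) (enc n) (rel n) (dec n)" for n
    unfolding nc_error_prob_def by (intro mult_nonneg_nonneg sum_nonneg prod_nonneg) auto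
  ultimately have "(\<lambda>n. nc_error_prob W2 W3 n (num_msgs n R) (enc n) (rel n) (dec n)) \<longlonglongrightarrow> 0"
    by (intro tendsto_sandwich[OF _ _ tendsto_const lim]) auto
  with code(1) R(1) show ?thesis unfolding nc_achievable_def by blast
qed

text \<open>\<open>achievable\<close> needs strict inequalities, so the bound is reached from below
  through every smaller extended real; values that are not positive, including minus infinity, are
  covered by rate 0.\<close>

lemma capacity_ge:
  "ereal (min (mi J (\<lambda>\<omega>. (fV \<omega>, fU \<omega>)) fY3 + cmi J fX1 (\<lambda>\<omega>. (fU \<omega>, fY3 \<omega>)) fV - cmi J fU fY2 fV)
     (min (mi J fV fY2 + cmi J fX1 (\<lambda>\<omega>. (fU \<omega>, fY3 \<omega>)) fV)
          (mi J fV fY2 + cmi J fX1 (\<lambda>\<omega>. (fU \<omega>, fY3 \<omega>)) fV + cmi J fU fY3 fV - cmi J fU fY2 fV)))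
    \<le> nc_capacity W2 W3" (is "ereal ?m \<le> _")
proof (rule dense_le)
  fix x assume x: "x < ereal ?m"
  have ub: "ereal R \<le> nc_capacity W2 W3" if "nc_achievable W2 W3 R" for R
    unfolding nc_capacity_def using that by (intro Sup_upper) auto
  show "x \<le> nc_capacity W2 W3"
  proof (cases "x \<le> 0")
    case True
    thus ?thesis using ub[OF nc_achievable_0] by (simp add: zero_ereal_def order_trans)
  next
    case False
    then obtain R where R: "x = ereal R" "0 \<le> R" using x by (cases x) auto
    have "R < ?m" using x R by simp
    hence "nc_achievable W2 W3 R"
      using R(2) cmi_X1_U mi_VU_X1 by (intro achievable) (auto simp: mi_VY2 cmi_UY2 cmi_X1)
    thus ?thesis using ub R by simp
  qed
qed

end

theorem theorem3:
  fixes W2 :: "'x1::finite \<Rightarrow> 'y2::finite pmf"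
    and W3 :: "'x1 \<Rightarrow> 'x2::finite \<Rightarrow> 'y2 \<Rightarrow> 'y3::finite pmf"
    and pVX :: "('v::finite \<times> 'x1) pmf"
    and pU :: "'v \<Rightarrow> 'y2 \<Rightarrow> 'u::finite pmf"
    and x2f :: "'u \<Rightarrow> 'v \<Rightarrow> 'y2 \<Rightarrow> 'x2"
  defines "J \<equiv> relay_joint pVX W2 pU x2f W3"
    and "V \<equiv> \<lambda>(v, x1, y2, u, x2, y3). v"
    and "X1 \<equiv> \<lambda>(v, x1, y2, u, x2, y3). x1"
    and "Y2 \<equiv> \<lambda>(v, x1, y2, u, x2, y3). y2"
    and "U \<equiv> \<lambda>(v, x1, y2, u, x2, y3). u"
    and "Y3 \<equiv> \<lambda>(v, x1, y2, u, x2, y3). y3"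
  shows "ereal (min (mi J (\<lambda>\<omega>. (V \<omega>, U \<omega>)) Y3 + cmi J X1 (\<lambda>\<omega>. (U \<omega>, Y3 \<omega>)) V - cmi J U Y2 V)
                (min (mi J V Y2 + cmi J X1 (\<lambda>\<omega>. (U \<omega>, Y3 \<omega>)) V)
                     (mi J V Y2 + cmi J X1 (\<lambda>\<omega>. (U \<omega>, Y3 \<omega>)) V + cmi J U Y3 V - cmi J U Y2 V)))
         \<le> nc_capacity W2 W3"
proof -
  obtain pX where pVX: "pVX = bind_pmf (map_pmf fst pVX) (\<lambda>v. map_pmf (Pair v) (pX v))"
    by (rule pmf_disintegrate)
  interpret S: relay_scheme W2 W3 "map_pmf fst pVX" pX pU x2f .
  have "J = S.J" unfolding J_def S.J_def pVX[symmetric] ..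
  moreover have "V = fV" "X1 = fX1" "Y2 = fY2" "U = fU" "Y3 = fY3"
    by (simp_all add: V_def X1_def Y2_def U_def Y3_def fV_def fX1_def fY2_def fU_def fY3_def)
  ultimately show ?thesis using S.capacity_ge by simp
qed

end
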